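(* Let $n\ge 3$, let $k$ be a field, let $M\supset k$ be an infinite field, and let $\mathbf a,\mathbf b\in M^n$ be such that $f_n(\mathbf a;X)$ and $f_n(\mathbf b;X)$ both have no multiple root. Fix $j$ with $0\le j\le n-1$ and assume that $F_j(\mathbf a,\mathbf b;X)\in M[X]$ has no multiple root. Assume that the Galois groups $G_{\mathbf a}=\mathrm{Gal}(\mathrm{Spl}_M f_n(\mathbf a;X)/M)$ and $G_{\mathbf b}=\mathrm{Gal}(\mathrm{Spl}_M f_n(\mathbf b;X)/M)$ are both isomorphic to a transitive subgroup $G$ of the symmetric group $\mathfrak S_n$, and that all subgroups of $G$ of index $n$ are conjugate in $G$. Then $F_j(\mathbf a,\mathbf b;X)$ has a root in $M$ if and only if the splitting fields $\mathrm{Spl}_M f_n(\mathbf a;X)$ and $\mathrm{Spl}_M f_n(\mathbf b;X)$ (in a fixed algebraic closure of $M$) coincide.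
   Context: For $\mathbf a=(a_1,\ldots,a_n)\in M^n$ put $f_n(\mathbf a;X)=X^n-a_1X^{n-1}+a_2X^{n-2}-\cdots+(-1)^na_n$. Let $\alpha_1,\ldots,\alpha_n$ and $\beta_1,\ldots,\beta_n$ be the roots of $f_n(\mathbf a;X)$ and $f_n(\mathbf b;X)$ in a fixed algebraic closure of $M$, in a fixed order. For $\tau\in\mathfrak S_n$ let $(c_0^{\tau},\ldots,c_{n-1}^{\tau})$ be the unique solution of the Vandermonde system $\beta_{\tau(i)}=c_0^{\tau}+c_1^{\tau}\alpha_i+\cdots+c_{n-1}^{\tau}\alpha_i^{n-1}$ ($i=1,\ldots,n$). Define $F_j(\mathbf a,\mathbf b;X)=\prod_{\tau\in\mathfrak S_n}(X-c_j^{\tau})\in M[X]$. $\mathrm{Spl}_M f$ denotes the splitting field of $f$ over $M$.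
   Formalization: Besides being isomorphic to G, the Galois groups of both polynomials are assumed to act transitively on their n roots; with mere abstract isomorphism the claim fails, e.g. over Q for X(X-1)(X-3)(X^3-2) and a suitable sextic that defines the splitting field of X^3-2. *)

theory Defs
  imports
    "HOL-Algebra.Algebraic_Closure_Type"
    "HOL-Algebra.Generated_Fields"
    "HOL-Algebra.Sym_Groups"
    "HOL-Algebra.Bij"
    "HOL-Algebra.Coset"
begin

text \<open>
  The field \<open>M\<close> is a type \<open>'m :: field\<close>, and its fixed algebraic closure is the type
  \<open>'m alg_closure\<close>, into which \<open>M\<close> embeds by \<^const>\<open>to_ac\<close>. A vector \<open>(a\<^sub>1, \<dots>, a\<^sub>n)\<close> is a
  function on \<open>nat\<close> of which only the values at \<open>1, \<dots>, n\<close> are used.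
\<close>

definition f_poly :: "nat \<Rightarrow> (nat \<Rightarrow> 'm) \<Rightarrow> 'm :: field poly" where
  "f_poly n a = Polynomial.monom 1 n + (\<Sum>i=1..n. Polynomial.monom ((-1) ^ i * a i) (n - i))"

definition lists_roots :: "nat \<Rightarrow> 'm :: field poly \<Rightarrow> (nat \<Rightarrow> 'm alg_closure) \<Rightarrow> bool" where
  "lists_roots n f \<alpha> \<longleftrightarrow> map_poly to_ac f = (\<Prod>i=1..n. [:- \<alpha> i, 1:])"

text \<open>
  The condition \<open>c \<in> extensional {..<n}\<close> fixes the irrelevant values \<open>c l\<close> for \<open>l \<ge> n\<close>, so that
  the solution is unique as a function whenever \<open>\<alpha> 1, \<dots>, \<alpha> n\<close> are distinct.
\<close>

definition vandermonde_sol ::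
    "nat \<Rightarrow> (nat \<Rightarrow> 'c) \<Rightarrow> (nat \<Rightarrow> 'c) \<Rightarrow> (nat \<Rightarrow> nat) \<Rightarrow> nat \<Rightarrow> 'c :: field" where
  "vandermonde_sol n \<alpha> \<beta> \<tau> =
     (THE c. c \<in> extensional {..<n} \<and> (\<forall>i\<in>{1..n}. \<beta> (\<tau> i) = (\<Sum>l<n. c l * \<alpha> i ^ l)))"

definition F_poly :: "nat \<Rightarrow> nat \<Rightarrow> (nat \<Rightarrow> 'c) \<Rightarrow> (nat \<Rightarrow> 'c) \<Rightarrow> 'c :: field poly" where
  "F_poly n j \<alpha> \<beta> = (\<Prod>\<tau> | \<tau> permutes {1..n}. [:- vandermonde_sol n \<alpha> \<beta> \<tau> j, 1:])"

definition roots_in_closure :: "'m :: field poly \<Rightarrow> 'm alg_closure set" where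
  "roots_in_closure f = {x. poly (map_poly to_ac f) x = 0}"

definition Spl :: "'m :: field poly \<Rightarrow> 'm alg_closure set" where
  "Spl f = generate_field ring_of_type_algebra (range to_ac \<union> roots_in_closure f)"

text \<open>The automorphisms of \<open>L\<close> over \<open>M\<close>; as in \<^const>\<open>AutoGroup\<close>, they are extensional on \<open>L\<close>.\<close>

definition Gal :: "'m :: field alg_closure set \<Rightarrow> ('m alg_closure \<Rightarrow> 'm alg_closure) monoid" where
  "Gal L = BijGroup L \<lparr>carrier :=
     {\<sigma> \<in> Bij L. \<sigma> \<in> ring_hom (ring_of_type_algebra \<lparr>carrier := L\<rparr>) (ring_of_type_algebra \<lparr>carrier := L\<rparr>)
        \<and> (\<forall>x. \<sigma> (to_ac x) = to_ac x)}\<rparr>"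

abbreviation perm_group :: "nat \<Rightarrow> (nat \<Rightarrow> nat) set \<Rightarrow> (nat \<Rightarrow> nat) monoid" where
  "perm_group n G \<equiv> sym_group n \<lparr>carrier := G\<rparr>"

definition transitive_subgroup :: "nat \<Rightarrow> (nat \<Rightarrow> nat) set \<Rightarrow> bool" where
  "transitive_subgroup n G \<longleftrightarrow>
     subgroup G (sym_group n) \<and> (\<forall>i\<in>{1..n}. \<forall>l\<in>{1..n}. \<exists>g\<in>G. g i = l)"

text \<open>
  The Galois group of a separable polynomial of degree \<open>n\<close> is isomorphic to a subgroup of \<open>S\<^sub>n\<close>
  through its action on the roots, and to call it a transitive subgroup is a statement about this
  action. It does not follow from isomorphism as an abstract group with a transitive subgroup: over
  the rationals, \<open>X (X - 1) (X - 3) (X\<^sup>3 - 2)\<close> has an intransitive Galois group isomorphic to the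
  regular copy of \<open>S\<^sub>3\<close> in \<open>S\<^sub>6\<close>, which is transitive.
\<close>

definition Gal_transitive_on_roots :: "'m :: field poly \<Rightarrow> bool" where
  "Gal_transitive_on_roots f \<longleftrightarrow>
     (\<forall>x\<in>roots_in_closure f. \<forall>y\<in>roots_in_closure f. \<exists>\<sigma>\<in>carrier (Gal (Spl f)). \<sigma> x = y)"

definition index_subgroups_conjugate :: "('g, 'b) monoid_scheme \<Rightarrow> nat \<Rightarrow> bool" where
  "index_subgroups_conjugate G n \<longleftrightarrow>
     (\<forall>H K. subgroup H G \<and> card (rcosets\<^bsub>G\<^esub> H) = n \<and> subgroup K G \<and> card (rcosets\<^bsub>G\<^esub> K) = n \<longrightarrow>
        (\<exists>g\<in>carrier G. K = (\<lambda>h. g \<otimes>\<^bsub>G\<^esub> h \<otimes>\<^bsub>G\<^esub> inv\<^bsub>G\<^esub> g) ` H))"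

end

theory Submission
  imports Defs "HOL-Algebra.Group_Action"
begin

text \<open>
  An element of \<open>M(R)\<close>, with \<open>R\<close> a finite set of separable elements, lies in \<open>M\<close> as soon as it is
  fixed by all embeddings of \<open>M(R)\<close> over \<open>M\<close>. Such an embedding acts by permutations \<open>s\<close> and \<open>t\<close>
  on the roots \<open>\<alpha> i\<close> and \<open>\<beta> i\<close>, and by uniqueness of the Vandermonde solution it sends the
  coefficients \<open>c\<^sup>\<tau>\<close> to \<open>c\<^sup>\<tau>'\<close> with \<open>\<tau>' = t \<tau> s\<^sup>-\<^sup>1\<close>. Hence all \<open>c\<^sup>\<tau> l\<close> lie in \<open>M\<close> if \<open>\<tau>\<close> is
  equivariant.

  If \<open>F\<^sub>j\<close> has the root \<open>c\<^sup>\<tau> j\<close> in \<open>M\<close>, simplicity of its roots forces \<open>\<tau>' = \<tau>\<close>. So \<open>\<tau>\<close> is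
  equivariant, each \<open>\<beta> i\<close> is a polynomial over \<open>M\<close> in some \<open>\<alpha> k\<close>, and vice versa with \<open>\<tau>\<^sup>-\<^sup>1\<close>.
  Conversely, if the splitting fields coincide, the stabilizers of \<open>\<alpha> 1\<close> and \<open>\<beta> 1\<close> both have
  index \<open>n\<close>, and their conjugacy yields an equivariant \<open>\<tau>\<close>.
\<close>

subsection \<open>Polynomials over a subfield and simple extensions\<close>

text \<open>Subfields are sets inside a field type rather than ring records, so that the type
  \<open>poly\<close> and its theory apply directly. Closure under \<open>inverse\<close> includes
  0, where \<open>inverse 0 = 0\<close>.\<close>

locale field_subset =
  fixes K :: "'a :: field set"
  assumes one_mem: "1 \<in> K"
    and diff_mem: "x \<in> K \<Longrightarrow> y \<in> K \<Longrightarrow> x - y \<in> K"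
    and mult_mem: "x \<in> K \<Longrightarrow> y \<in> K \<Longrightarrow> x * y \<in> K"
    and inverse_mem: "x \<in> K \<Longrightarrow> inverse x \<in> K"
begin

lemma zero_mem: "0 \<in> K"
  using diff_mem[OF one_mem one_mem] by simp

lemma uminus_mem: "x \<in> K \<Longrightarrow> - x \<in> K"
  using diff_mem[OF zero_mem] by simp

lemma add_mem: "x \<in> K \<Longrightarrow> y \<in> K \<Longrightarrow> x + y \<in> K"
  using diff_mem[of x "- y"] uminus_mem by simp

lemma divide_mem: "x \<in> K \<Longrightarrow> y \<in> K \<Longrightarrow> x / y \<in> K"
  by (simp add: divide_inverse mult_mem inverse_mem)

lemma power_mem: "x \<in> K \<Longrightarrow> x ^ n \<in> K"
  by (induction n) (auto intro: one_mem mult_mem)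

lemma sum_mem: "(\<And>i. i \<in> I \<Longrightarrow> f i \<in> K) \<Longrightarrow> sum f I \<in> K"
  by (induction I rule: infinite_finite_induct) (auto intro: zero_mem add_mem)

lemmas mem_intros =
  zero_mem one_mem uminus_mem add_mem diff_mem mult_mem inverse_mem divide_mem power_mem sum_mem

end

text \<open>This is K[X] inside the polynomial ring of the ambient type, so that its members can be
  evaluated at points outside \<open>K\<close>.\<close>

definition polys_over :: "'a :: zero set \<Rightarrow> 'a poly set" where
  "polys_over K = {p. \<forall>i. Polynomial.coeff p i \<in> K}"

lemma polys_over_mono: "K \<subseteq> L \<Longrightarrow> polys_over K \<subseteq> polys_over L"
  by (auto simp: polys_over_def)

context field_subset
begin

lemma polys_0: "0 \<in> polys_over K"
  by (simp add: polys_over_def zero_mem)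

lemma polys_const: "c \<in> K \<Longrightarrow> [:c:] \<in> polys_over K"
  by (simp add: polys_over_def coeff_pCons zero_mem split: nat.split)

lemma polys_linear: "c \<in> K \<Longrightarrow> d \<in> K \<Longrightarrow> [:c, d:] \<in> polys_over K"
  by (simp add: polys_over_def coeff_pCons zero_mem split: nat.split)

lemma polys_monom: "c \<in> K \<Longrightarrow> Polynomial.monom c n \<in> polys_over K"
  by (simp add: polys_over_def zero_mem)

lemma polys_uminus: "p \<in> polys_over K \<Longrightarrow> - p \<in> polys_over K"
  by (simp add: polys_over_def uminus_mem)

lemma polys_add: "p \<in> polys_over K \<Longrightarrow> q \<in> polys_over K \<Longrightarrow> p + q \<in> polys_over K"
  by (simp add: polys_over_def add_mem)

lemma polys_diff: "p \<in> polys_over K \<Longrightarrow> q \<in> polys_over K \<Longrightarrow> p - q \<in> polys_over K"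
  by (simp add: polys_over_def diff_mem)

lemma polys_smult: "c \<in> K \<Longrightarrow> p \<in> polys_over K \<Longrightarrow> Polynomial.smult c p \<in> polys_over K"
  by (simp add: polys_over_def mult_mem)

lemma polys_mult: "p \<in> polys_over K \<Longrightarrow> q \<in> polys_over K \<Longrightarrow> p * q \<in> polys_over K"
  by (auto simp: polys_over_def coeff_mult intro!: mem_intros)

lemma polys_prod: "(\<And>i. i \<in> I \<Longrightarrow> f i \<in> polys_over K) \<Longrightarrow> prod f I \<in> polys_over K"
  by (induction I rule: infinite_finite_induct)
     (auto intro: polys_mult polys_const simp: one_pCons one_mem)

lemma poly_mem: "p \<in> polys_over K \<Longrightarrow> x \<in> K \<Longrightarrow> poly p x \<in> K"
  by (auto simp: polys_over_def poly_altdef intro!: mem_intros)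

text \<open>Long division: subtracting \<open>t * q\<close>, with \<open>t\<close> chosen to cancel
  the leading term of \<open>p\<close>, lowers the degree and never leaves \<open>K\<close>.\<close>

lemma polys_division:
  assumes "p \<in> polys_over K" "q \<in> polys_over K" "q \<noteq> 0"
  shows "\<exists>s\<in>polys_over K. \<exists>r\<in>polys_over K.
           p = s * q + r \<and> (r = 0 \<or> Polynomial.degree r < Polynomial.degree q)"
  using assms(1)
proof (induction "Polynomial.degree p" arbitrary: p rule: less_induct)
  case less
  show ?case
  proof (cases "p = 0 \<or> Polynomial.degree p < Polynomial.degree q")
    case True
    then show ?thesis
      using less.prems polys_0 by (intro bexI[of _ 0] bexI[of _ p]) auto
  next
    case False
    define t where "t = Polynomial.monom (Polynomial.lead_coeff p / Polynomial.lead_coeff q)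
                          (Polynomial.degree p - Polynomial.degree q)"
    define p' where "p' = p - t * q"
    have t: "t \<in> polys_over K"
      unfolding t_def using less.prems assms(2)
      by (intro polys_monom divide_mem) (auto simp: polys_over_def)
    have p': "p' \<in> polys_over K"
      unfolding p'_def by (intro polys_diff polys_mult less.prems assms t)
    have nz: "Polynomial.lead_coeff p / Polynomial.lead_coeff q \<noteq> 0"
      using False assms(3) by auto
    have "t \<noteq> 0" using nz by (simp add: t_def)
    have degree_t: "Polynomial.degree t = Polynomial.degree p - Polynomial.degree q"
      unfolding t_def by (rule degree_monom_eq[OF nz])
    have deg: "Polynomial.degree (t * q) = Polynomial.degree p"
      using False assms(3) \<open>t \<noteq> 0\<close> degree_t by (simp add: degree_mult_eq)
    have lc: "Polynomial.lead_coeff (t * q) = Polynomial.lead_coeff p"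
      using assms(3) by (simp add: lead_coeff_mult degree_t) (simp add: t_def)
    have "p' = 0 \<or> Polynomial.degree p' < Polynomial.degree p"
    proof (cases "p' = 0")
      case False
      have "Polynomial.coeff p' (Polynomial.degree p) = 0"
        using lc deg by (simp add: p'_def)
      moreover have "Polynomial.degree p' \<le> Polynomial.degree p"
        unfolding p'_def using deg by (intro degree_diff_le) auto
      ultimately show ?thesis
        using False by (metis leading_coeff_0_iff order_le_imp_less_or_eq)
    qed simp
    then have "\<exists>s\<in>polys_over K. \<exists>r\<in>polys_over K.
        p' = s * q + r \<and> (r = 0 \<or> Polynomial.degree r < Polynomial.degree q)"
    proof
      assume "p' = 0"
      then show ?thesis
        using polys_0 by (intro bexI[of _ 0] bexI[of _ 0]) auto
    qed (use less.hyps p' in blast)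
    then obtain s r where sr: "s \<in> polys_over K" "r \<in> polys_over K" "p' = s * q + r"
        "r = 0 \<or> Polynomial.degree r < Polynomial.degree q"
      by blast
    have "p = (s + t) * q + r"
      using sr(3) by (simp add: p'_def algebra_simps)
    then show ?thesis
      using sr polys_add[OF sr(1) t] by blast
  qed
qed

text \<open>A generator of the ideal of polynomials over \<open>K\<close> that vanish at
  \<open>y\<close>. It is not normalized to be monic, hence determined only up to a constant factor;
  the arguments below use just its degree and divisibility by it.\<close>

definition minpoly_of :: "'a \<Rightarrow> 'a poly \<Rightarrow> bool" where
  "minpoly_of y m \<longleftrightarrow> m \<in> polys_over K \<and> m \<noteq> 0 \<and> poly m y = 0 \<and>
     (\<forall>q\<in>polys_over K. poly q y = 0 \<longrightarrow> (\<exists>s\<in>polys_over K. q = s * m))"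

text \<open>An annihilating polynomial of least degree works: the remainder of any other one after
  division by it also vanishes at \<open>y\<close>, so it is zero.\<close>

lemma minpoly_exists:
  assumes "p \<in> polys_over K" "p \<noteq> 0" "poly p y = 0"
  obtains m where "minpoly_of y m"
proof -
  define A where "A = (\<lambda>m. m \<in> polys_over K \<and> m \<noteq> 0 \<and> poly m y = 0)"
  obtain m where m: "A m" and min: "\<And>q. A q \<Longrightarrow> Polynomial.degree m \<le> Polynomial.degree q"
    using ex_has_least_nat[of A p Polynomial.degree] assms by (auto simp: A_def)
  have "\<exists>s\<in>polys_over K. q = s * m" if q: "q \<in> polys_over K" "poly q y = 0" for q
  proof -
    obtain s r where sr: "s \<in> polys_over K" "r \<in> polys_over K" "q = s * m + r"
        "r = 0 \<or> Polynomial.degree r < Polynomial.degree m"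
      using polys_division[OF q(1)] m unfolding A_def by blast
    have "poly r y = 0" using sr(3) q(2) m by (simp add: A_def)
    then have "r = 0" using min[of r] sr(2,4) leD unfolding A_def by blast
    then show ?thesis using sr by auto
  qed
  then show ?thesis using that m by (auto simp: minpoly_of_def A_def)
qed

lemma minpoly_degree_pos:
  assumes "minpoly_of y m"
  shows "Polynomial.degree m > 0"
proof (rule ccontr)
  assume "\<not> ?thesis"
  then obtain c where "m = [:c:]" by (auto elim: degree_eq_zeroE)
  then show False using assms by (auto simp: minpoly_of_def)
qed

lemma minpoly_degree_le:
  assumes "minpoly_of y m" "q \<in> polys_over K" "q \<noteq> 0" "poly q y = 0"
  shows "Polynomial.degree m \<le> Polynomial.degree q"
proof -
  obtain s where s: "q = s * m"
    using assms unfolding minpoly_of_def by blast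
  show ?thesis using assms(3) unfolding s by (simp add: degree_mult_eq)
qed

text \<open>Euclidean descent. From \<open>m = s * q + r\<close> follows r(y) = - s(y) q(y), so an
  inverse of r(y) yields one of q(y), and \<open>r\<close> has smaller degree than \<open>q\<close>.
  The descent ends at a nonzero constant.\<close>

lemma minpoly_inverse_aux:
  assumes m: "minpoly_of y m"
    and "q \<in> polys_over K" "q \<noteq> 0" "Polynomial.degree q < Polynomial.degree m"
  shows "\<exists>t\<in>polys_over K. poly q y * poly t y = 1"
  using assms(2-4)
proof (induction "Polynomial.degree q" arbitrary: q rule: less_induct)
  case less
  show ?case
  proof (cases "Polynomial.degree q = 0")
    case True
    then obtain c where c: "q = [:c:]" by (auto elim: degree_eq_zeroE)
    then have "c \<noteq> 0" "c \<in> K" using less.prems by (auto simp: polys_over_def dest: spec[of _ 0])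
    then show ?thesis using c
      by (intro bexI[of _ "[:inverse c:]"]) (auto intro: polys_const inverse_mem)
  next
    case False
    obtain s r where sr: "s \<in> polys_over K" "r \<in> polys_over K" "m = s * q + r"
        "r = 0 \<or> Polynomial.degree r < Polynomial.degree q"
      using polys_division[of m q] m less.prems unfolding minpoly_of_def by blast
    have my: "poly m y = 0" "m \<noteq> 0" using m by (auto simp: minpoly_of_def)
    have qy: "poly q y \<noteq> 0"
      using minpoly_degree_le[OF m less.prems(1,2)] less.prems(3) by auto
    \<comment> \<open>Otherwise the cofactor \<open>s\<close> would be a nonzero polynomial over
      \<open>K\<close> vanishing at \<open>y\<close>, of degree below that of
      \<open>m\<close>.\<close>
    have "r \<noteq> 0"
    proof
      assume "r = 0"
      with sr my have msq: "m = s * q" by simp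
      with my qy have "s \<noteq> 0" "q \<noteq> 0" "poly s y = 0" by auto
      with minpoly_degree_le[OF m sr(1)] msq False show False
        by (simp add: degree_mult_eq)
    qed
    then obtain t where t: "t \<in> polys_over K" "poly r y * poly t y = 1"
      using less.hyps[of r] sr less.prems(3) by auto
    have "poly r y = - (poly s y * poly q y)"
      using my(1) sr(3) by (simp add: add_eq_0_iff)
    then have "poly q y * poly (- (s * t)) y = 1"
      using t(2) by (simp add: mult_ac)
    then show ?thesis
      using polys_uminus[OF polys_mult[OF sr(1) t(1)]] by blast
  qed
qed

text \<open>The ring K[y]; once \<open>y\<close> has a minimal polynomial it is the field K(y), by
  \<open>adjoin_eq_gen_field\<close>.\<close>

definition adjoin :: "'a \<Rightarrow> 'a set" where
  "adjoin y = (\<lambda>p. poly p y) ` polys_over K"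

lemma adjoin_reduce:
  assumes m: "minpoly_of y m" and "x \<in> adjoin y"
  obtains r where "r \<in> polys_over K" "Polynomial.degree r < Polynomial.degree m" "x = poly r y"
proof -
  obtain p where p: "p \<in> polys_over K" "x = poly p y"
    using assms by (auto simp: adjoin_def)
  obtain s r where sr: "s \<in> polys_over K" "r \<in> polys_over K" "p = s * m + r"
      "r = 0 \<or> Polynomial.degree r < Polynomial.degree m"
    using polys_division[OF p(1)] m unfolding minpoly_of_def by blast
  have "x = poly r y" using p(2) sr(3) m by (simp add: minpoly_of_def)
  then show ?thesis using that sr minpoly_degree_pos[OF m] by auto
qed

lemma subset_adjoin: "K \<subseteq> adjoin y"
  by (auto simp: adjoin_def image_iff intro!: bexI[of _ "[:_:]"] polys_const)

lemma gen_mem_adjoin: "y \<in> adjoin y"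
  by (auto simp: adjoin_def image_iff intro!: bexI[of _ "[:0, 1:]"] polys_linear mem_intros)

lemma field_subset_adjoin:
  assumes m: "minpoly_of y m"
  shows "field_subset (adjoin y)"
proof
  show "1 \<in> adjoin y" using subset_adjoin one_mem by blast
next
  fix u v assume "u \<in> adjoin y" "v \<in> adjoin y"
  then obtain p q where pq: "p \<in> polys_over K" "q \<in> polys_over K" "u = poly p y" "v = poly q y"
    by (auto simp: adjoin_def)
  show "u - v \<in> adjoin y" "u * v \<in> adjoin y"
    using polys_diff[OF pq(1,2)] polys_mult[OF pq(1,2)] pq(3,4)
    by (force simp: adjoin_def)+
next
  fix u assume u: "u \<in> adjoin y"
  show "inverse u \<in> adjoin y"
  proof (cases "u = 0")
    case False
    obtain r where r: "r \<in> polys_over K" "Polynomial.degree r < Polynomial.degree m" "u = poly r y"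
      using adjoin_reduce[OF m u] .
    then obtain t where t: "t \<in> polys_over K" "poly r y * poly t y = 1"
      using minpoly_inverse_aux[OF m r(1)] False by fastforce
    then have "inverse u = poly t y" using r(3) by (simp add: inverse_unique)
    then show ?thesis using t by (auto simp: adjoin_def)
  qed (use subset_adjoin zero_mem in auto)
qed

end

text \<open>The map is a total function of which only the values on \<open>K\<close> are
  constrained. Injectivity is a consequence, since a nonzero element of \<open>K\<close> has its
  inverse in \<open>K\<close>.\<close>

locale field_hom_on = field_subset K for K :: "'a :: field set" +
  fixes \<phi> :: "'a \<Rightarrow> 'b :: field"
  assumes hom_one: "\<phi> 1 = 1"
    and hom_diff: "x \<in> K \<Longrightarrow> y \<in> K \<Longrightarrow> \<phi> (x - y) = \<phi> x - \<phi> y"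
    and hom_mult: "x \<in> K \<Longrightarrow> y \<in> K \<Longrightarrow> \<phi> (x * y) = \<phi> x * \<phi> y"
begin

lemma hom_zero: "\<phi> 0 = 0"
  using hom_diff[OF one_mem one_mem] by simp

lemma hom_uminus: "x \<in> K \<Longrightarrow> \<phi> (- x) = - \<phi> x"
  using hom_diff[OF zero_mem] hom_zero by simp

lemma hom_add: "x \<in> K \<Longrightarrow> y \<in> K \<Longrightarrow> \<phi> (x + y) = \<phi> x + \<phi> y"
  using hom_diff[of x "- y"] uminus_mem hom_uminus by simp

lemma hom_sum: "(\<And>i. i \<in> I \<Longrightarrow> f i \<in> K) \<Longrightarrow> \<phi> (sum f I) = (\<Sum>i\<in>I. \<phi> (f i))"
  by (induction I rule: infinite_finite_induct) (auto simp: hom_zero hom_add sum_mem)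

lemma hom_power: "x \<in> K \<Longrightarrow> \<phi> (x ^ n) = \<phi> x ^ n"
  by (induction n) (auto simp: hom_one hom_mult power_mem)

lemma hom_eq_0_iff: "x \<in> K \<Longrightarrow> \<phi> x = 0 \<longleftrightarrow> x = 0"
  using hom_mult[OF _ inverse_mem, of x x] hom_one hom_zero by (cases "x = 0") auto

lemma hom_inj: "inj_on \<phi> K"
  by (rule inj_onI) (metis diff_mem eq_iff_diff_eq_0 hom_diff hom_eq_0_iff)

lemma hom_inverse: "x \<in> K \<Longrightarrow> \<phi> (inverse x) = inverse (\<phi> x)"
  using hom_mult[OF _ inverse_mem, of x x] hom_one hom_zero
  by (cases "x = 0") (auto intro!: inverse_unique[symmetric])

lemma map_poly_hom_mult:
  assumes "p \<in> polys_over K" "q \<in> polys_over K"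
  shows "map_poly \<phi> (p * q) = map_poly \<phi> p * map_poly \<phi> q"
proof (rule poly_eqI)
  fix i
  show "Polynomial.coeff (map_poly \<phi> (p * q)) i = Polynomial.coeff (map_poly \<phi> p * map_poly \<phi> q) i"
    using assms unfolding polys_over_def
    by (simp add: coeff_map_poly hom_zero coeff_mult hom_sum mult_mem hom_mult)
qed

lemma map_poly_hom_diff:
  assumes "p \<in> polys_over K" "q \<in> polys_over K"
  shows "map_poly \<phi> (p - q) = map_poly \<phi> p - map_poly \<phi> q"
  using assms unfolding polys_over_def
  by (intro poly_eqI) (simp add: coeff_map_poly hom_zero hom_diff)

lemma map_poly_hom_degree:
  assumes "p \<in> polys_over K"
  shows "Polynomial.degree (map_poly \<phi> p) = Polynomial.degree p"
  using assms
  by (cases "p = 0") (auto intro!: map_poly_degree_eq simp: polys_over_def hom_eq_0_iff)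

lemma hom_poly:
  assumes "p \<in> polys_over K" "x \<in> K"
  shows "\<phi> (poly p x) = poly (map_poly \<phi> p) (\<phi> x)"
  using assms unfolding poly_altdef map_poly_hom_degree[OF assms(1)] polys_over_def
  by (simp add: hom_sum mem_intros hom_mult hom_power coeff_map_poly hom_zero)

text \<open>The extension evaluates at \<open>z\<close> the image under \<open>\<phi>\<close> of a
  polynomial representing the element. Two representing polynomials differ by a multiple of
  \<open>m\<close>, whose image vanishes at \<open>z\<close>.\<close>

lemma extend_to_adjoin:
  assumes m: "minpoly_of y m" and z: "poly (map_poly \<phi> m) z = 0"
  obtains \<psi> where "field_hom_on (adjoin y) \<psi>" "\<And>x. x \<in> K \<Longrightarrow> \<psi> x = \<phi> x" "\<psi> y = z"
proof -
  \<comment> \<open>The representing polynomial is an arbitrary choice; the next fact shows that the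
    value does not depend on it.\<close>
  define \<psi> where "\<psi> u = poly (map_poly \<phi> (SOME p. p \<in> polys_over K \<and> u = poly p y)) z" for u
  have \<psi>: "\<psi> (poly p y) = poly (map_poly \<phi> p) z" if p: "p \<in> polys_over K" for p
  proof -
    define q where "q = (SOME q. q \<in> polys_over K \<and> poly p y = poly q y)"
    have q: "q \<in> polys_over K" "poly p y = poly q y"
      using someI[of "\<lambda>q. q \<in> polys_over K \<and> poly p y = poly q y" p] p by (auto simp: q_def)
    have "p - q \<in> polys_over K" "poly (p - q) y = 0"
      using p q by (auto intro: polys_diff)
    then obtain s where s: "s \<in> polys_over K" "p - q = s * m"
      using m unfolding minpoly_of_def by blast
    have "map_poly \<phi> p - map_poly \<phi> q = map_poly \<phi> s * map_poly \<phi> m"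
      using map_poly_hom_diff[OF p q(1)] map_poly_hom_mult[OF s(1), of m] s(2) m
      by (simp add: minpoly_of_def)
    then have "poly (map_poly \<phi> p - map_poly \<phi> q) z = 0"
      using z by simp
    then show ?thesis by (simp add: \<psi>_def q_def)
  qed
  interpret A: field_subset "adjoin y" by (rule field_subset_adjoin[OF m])
  have const: "\<psi> x = \<phi> x" if "x \<in> K" for x
    using \<psi>[OF polys_const[OF that]] by (simp add: map_poly_pCons hom_zero)
  show ?thesis
  proof
    show "field_hom_on (adjoin y) \<psi>"
    proof
      show "\<psi> 1 = 1" using const[OF one_mem] hom_one by simp
    next
      fix u v assume "u \<in> adjoin y" "v \<in> adjoin y"
      then obtain p q where pq: "p \<in> polys_over K" "q \<in> polys_over K" "u = poly p y" "v = poly q y"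
        by (auto simp: adjoin_def)
      show "\<psi> (u - v) = \<psi> u - \<psi> v"
        using \<psi>[OF polys_diff[OF pq(1,2)]] \<psi>[OF pq(1)] \<psi>[OF pq(2)] pq
        by (simp add: map_poly_hom_diff)
      show "\<psi> (u * v) = \<psi> u * \<psi> v"
        using \<psi>[OF polys_mult[OF pq(1,2)]] \<psi>[OF pq(1)] \<psi>[OF pq(2)] pq
        by (simp add: map_poly_hom_mult)
    qed
    show "\<psi> y = z"
      using \<psi>[OF polys_linear[OF zero_mem one_mem]] by (simp add: map_poly_pCons hom_zero hom_one)
  qed (rule const)
qed

end

subsection \<open>Elements fixed by all embeddings\<close>

abbreviation gen_field :: "'a :: field set \<Rightarrow> 'a set" where
  "gen_field S \<equiv> generate_field ring_of_type_algebra S"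

lemma ring_of_type_algebra_simps:
  "carrier ring_of_type_algebra = UNIV"
  "x \<otimes>\<^bsub>ring_of_type_algebra\<^esub> y = x * y"
  "x \<oplus>\<^bsub>ring_of_type_algebra\<^esub> y = x + y"
  "\<one>\<^bsub>ring_of_type_algebra\<^esub> = 1"
  "\<zero>\<^bsub>ring_of_type_algebra\<^esub> = 0"
  by (simp_all add: ring_of_type_algebra_def)

lemma ring_of_type_algebra_a_inv:
  "\<ominus>\<^bsub>ring_of_type_algebra\<^esub> x = - (x :: 'a :: field)"
proof -
  interpret field "ring_of_type_algebra :: 'a ring" by (rule field_from_type_algebra)
  show ?thesis
    using minus_equality[of "- x" x] by (simp add: ring_of_type_algebra_simps)
qed

lemma ring_of_type_algebra_m_inv:
  assumes "x \<noteq> 0"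
  shows "inv\<^bsub>ring_of_type_algebra\<^esub> x = inverse (x :: 'a :: field)"
proof -
  interpret field "ring_of_type_algebra :: 'a ring" by (rule field_from_type_algebra)
  show ?thesis
    using comm_inv_char[of x "inverse x"] assms by (simp add: ring_of_type_algebra_simps)
qed

lemma field_subset_gen_field: "field_subset (gen_field S)"
proof
  show "1 \<in> gen_field S"
    using generate_field.one[of ring_of_type_algebra S] by (simp add: ring_of_type_algebra_simps)
next
  fix x y assume xy: "x \<in> gen_field S" "y \<in> gen_field S"
  have "- y \<in> gen_field S"
    using generate_field.a_inv[OF xy(2)] by (simp add: ring_of_type_algebra_a_inv)
  from generate_field.eng_add[OF xy(1) this] show "x - y \<in> gen_field S"
    by (simp add: ring_of_type_algebra_simps)
  show "x * y \<in> gen_field S"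
    using generate_field.eng_mult[OF xy] by (simp add: ring_of_type_algebra_simps)
  show "inverse x \<in> gen_field S"
  proof (cases "x = 0")
    case False
    then show ?thesis using generate_field.m_inv[OF xy(1)]
      by (simp add: ring_of_type_algebra_simps ring_of_type_algebra_m_inv)
  qed (use xy in simp)
qed

lemma subset_gen_field: "S \<subseteq> gen_field S"
  by (auto intro: generate_field.incl)

lemma gen_field_least:
  assumes "field_subset E" "S \<subseteq> E"
  shows "gen_field S \<subseteq> E"
proof
  interpret field_subset E by fact
  fix x assume "x \<in> gen_field S"
  then show "x \<in> E"
    by induction (use assms(2) in \<open>auto simp: ring_of_type_algebra_simps
        ring_of_type_algebra_a_inv ring_of_type_algebra_m_inv intro: mem_intros\<close>)
qed

lemma gen_field_subset: "S \<subseteq> gen_field T \<Longrightarrow> gen_field S \<subseteq> gen_field T"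
  using gen_field_least field_subset_gen_field by blast

lemma gen_field_mono: "S \<subseteq> T \<Longrightarrow> gen_field S \<subseteq> gen_field T"
  using gen_field_subset subset_gen_field by (meson subset_trans)

lemma gen_field_eq: "field_subset K \<Longrightarrow> gen_field K = K"
  using gen_field_least subset_gen_field by blast

lemma (in field_subset) adjoin_eq_gen_field:
  assumes "minpoly_of y m"
  shows "adjoin y = gen_field (K \<union> {y})"
proof
  show "gen_field (K \<union> {y}) \<subseteq> adjoin y"
    using field_subset_adjoin[OF assms] subset_adjoin gen_mem_adjoin by (intro gen_field_least) auto
  interpret L: field_subset "gen_field (K \<union> {y})" by (rule field_subset_gen_field)
  have "y \<in> gen_field (K \<union> {y})" "polys_over K \<subseteq> polys_over (gen_field (K \<union> {y}))"
    using subset_gen_field[of "K \<union> {y}"] by (auto intro!: polys_over_mono)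
  then show "adjoin y \<subseteq> gen_field (K \<union> {y})"
    unfolding adjoin_def using L.poly_mem by blast
qed

lemma gen_field_insert: "gen_field (gen_field S \<union> {y}) = gen_field (insert y S)"
proof
  show "gen_field (gen_field S \<union> {y}) \<subseteq> gen_field (insert y S)"
    using gen_field_mono[of S "insert y S"] subset_gen_field[of "insert y S"]
    by (intro gen_field_subset) auto
  show "gen_field (insert y S) \<subseteq> gen_field (gen_field S \<union> {y})"
    using subset_gen_field[of S] by (intro gen_field_mono) auto
qed

text \<open>That \<open>S\<close> is a set makes the linear factors distinct: \<open>y\<close> is a
  root of a polynomial over \<open>K\<close> that splits in the ambient field without multiple
  roots.\<close>

definition separable_over :: "'a :: field set \<Rightarrow> 'a \<Rightarrow> bool" where
  "separable_over K y \<longleftrightarrow> (\<exists>S. finite S \<and> y \<in> S \<and> (\<Prod>s\<in>S. [:- s, 1:]) \<in> polys_over K)"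

lemma separable_over_mono: "K \<subseteq> L \<Longrightarrow> separable_over K y \<Longrightarrow> separable_over L y"
  unfolding separable_over_def using polys_over_mono by blast

lemma poly_prod_linear_eq_0_iff:
  fixes S :: "'a :: idom set"
  shows "finite S \<Longrightarrow> poly (\<Prod>s\<in>S. [:- s, 1:]) x = 0 \<longleftrightarrow> x \<in> S"
  by (auto simp: poly_prod)

lemma prod_linear_nonzero: "(\<Prod>s\<in>S. [:- f s, 1 :: 'a :: idom:]) \<noteq> 0"
  by (induction S rule: infinite_finite_induct) (auto simp del: mult_pCons_left)

lemma degree_prod_linear:
  "Polynomial.degree (\<Prod>s\<in>S. [:- f s, 1 :: 'a :: idom:]) = card S"
  by (subst degree_prod_eq_sum_degree) auto

text \<open>A count of roots. Let P = q m be the split polynomial with root set \<open>S\<close>.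
  Its deg q + deg m distinct roots are roots of \<open>q\<close> or of \<open>m\<close>, and
  \<open>q\<close> accounts for at most deg q of them, so \<open>m\<close> has deg m.\<close>

lemma (in field_subset) separable_minpoly:
  assumes "separable_over K y"
  obtains m where "minpoly_of y m" "card {z. poly m z = 0} = Polynomial.degree m"
proof -
  obtain S where S: "finite S" "y \<in> S" "(\<Prod>s\<in>S. [:- s, 1:]) \<in> polys_over K"
    using assms by (auto simp: separable_over_def)
  define P where "P = (\<Prod>s\<in>S. [:- s, 1:])"
  have P: "P \<noteq> 0" "poly P y = 0"
    using prod_linear_nonzero[of "\<lambda>s. s" S] S by (simp_all add: P_def poly_prod_linear_eq_0_iff)
  obtain m where m: "minpoly_of y m"
    using minpoly_exists[of P y] P S(3) unfolding P_def by blast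
  obtain q where q: "P = q * m" "m \<noteq> 0"
    using m P(2) S(3) unfolding minpoly_of_def P_def by blast
  have "q \<noteq> 0" using q P by auto
  have "S = {z. poly q z = 0} \<union> {z. poly m z = 0}"
    using poly_prod_linear_eq_0_iff[OF S(1)] q(1) unfolding P_def by auto
  then have "card S \<le> card {z. poly q z = 0} + card {z. poly m z = 0}"
    by (simp add: card_Un_le)
  also have "card {z. poly q z = 0} \<le> Polynomial.degree q"
    by (rule card_poly_roots_bound) fact
  finally have "card S \<le> Polynomial.degree q + card {z. poly m z = 0}" by simp
  moreover have "card S = Polynomial.degree q + Polynomial.degree m"
    using degree_prod_linear[of "\<lambda>s. s" S] q \<open>q \<noteq> 0\<close> by (simp add: degree_mult_eq flip: P_def)
  ultimately have "Polynomial.degree m \<le> card {z. poly m z = 0}" by simp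
  with card_poly_roots_bound[OF q(2)] have "card {z. poly m z = 0} = Polynomial.degree m" by simp
  with m show ?thesis by (rule that)
qed

text \<open>
  Writing an element of \<open>K(y)\<close> as \<open>r(y)\<close> with \<open>deg r < deg m\<close> for the minimal
  polynomial \<open>m\<close> of \<open>y\<close>, invariance under the embeddings \<open>y \<mapsto> z\<close> says that \<open>r - r(y)\<close> vanishes at
  all \<open>deg m\<close> roots \<open>z\<close> of \<open>m\<close>, so \<open>r\<close> is constant.
\<close>

lemma (in field_subset) fixed_by_embeddings_adjoin:
  assumes y: "minpoly_of y m" "card {z. poly m z = 0} = Polynomial.degree m"
    and x: "x \<in> adjoin y"
    and fixed: "\<And>\<psi>. field_hom_on (adjoin y) \<psi> \<Longrightarrow> (\<And>u. u \<in> K \<Longrightarrow> \<psi> u = u) \<Longrightarrow> \<psi> x = x"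
  shows "x \<in> K"
proof -
  obtain r where r: "r \<in> polys_over K" "Polynomial.degree r < Polynomial.degree m" "x = poly r y"
    using adjoin_reduce[OF y(1) x] .
  have "poly r z = poly [:x:] z" if z: "z \<in> {z. poly m z = 0}" for z
  proof -
    interpret id: field_hom_on K "\<lambda>u. u" by unfold_locales auto
    have id: "map_poly (\<lambda>u. u) p = p" for p :: "'a poly"
      by (rule poly_eqI) (simp add: coeff_map_poly)
    obtain \<psi> where \<psi>: "field_hom_on (adjoin y) \<psi>" "\<And>u. u \<in> K \<Longrightarrow> \<psi> u = u" "\<psi> y = z"
      using id.extend_to_adjoin[OF y(1), of z] z by (auto simp: id)
    interpret \<psi>: field_hom_on "adjoin y" \<psi> by fact
    have "map_poly \<psi> r = r"
      using \<psi>(2) r(1) by (intro poly_eqI) (simp add: coeff_map_poly \<psi>.hom_zero polys_over_def)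
    then have "\<psi> x = poly r z"
      using \<psi>.hom_poly[of r y] r polys_over_mono[OF subset_adjoin[of y]] gen_mem_adjoin \<psi>(3) by auto
    then show ?thesis using fixed[OF \<psi>(1,2)] by simp
  qed
  then have "r = [:x:]"
    by (rule poly_eqI_degree[where A = "{z. poly m z = 0}"]) (use r y(2) minpoly_degree_pos[OF y(1)] in auto)
  then show ?thesis using r(1) by (auto simp: polys_over_def dest: spec[of _ 0])
qed

text \<open>Induction on \<open>R\<close>, with \<open>y\<close> adjoined last to E = K(R).
  Embeddings of E(y) that fix \<open>E\<close> also fix \<open>K\<close>, so the simple case puts
  \<open>x\<close> into \<open>E\<close>. Every embedding of \<open>E\<close> over \<open>K\<close>
  extends to E(y), hence fixes \<open>x\<close>, and the induction hypothesis applies.\<close>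

lemma fixed_by_embeddings:
  fixes K :: "'a :: alg_closed_field set"
  assumes K: "field_subset K" and "finite R" and "\<And>y. y \<in> R \<Longrightarrow> separable_over K y"
    and "x \<in> gen_field (K \<union> R)"
    and "\<And>\<psi> :: 'a \<Rightarrow> 'a. field_hom_on (gen_field (K \<union> R)) \<psi> \<Longrightarrow>
           (\<And>u. u \<in> K \<Longrightarrow> \<psi> u = u) \<Longrightarrow> \<psi> x = x"
  shows "x \<in> K"
  using assms(2-5)
proof (induction R)
  case empty
  then show ?case by (simp add: gen_field_eq[OF K])
next
  case (insert y R)
  define E where "E = gen_field (K \<union> R)"
  interpret E: field_subset E unfolding E_def by (rule field_subset_gen_field)
  have KE: "K \<subseteq> E" using subset_gen_field[of "K \<union> R"] by (simp add: E_def)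
  have "separable_over E y"
    using insert.prems(1) separable_over_mono[OF KE] by blast
  then obtain m where m: "E.minpoly_of y m" "card {z. poly m z = 0} = Polynomial.degree m"
    using E.separable_minpoly by blast
  have adj: "E.adjoin y = gen_field (K \<union> insert y R)"
    unfolding E.adjoin_eq_gen_field[OF m(1)] using gen_field_insert[of "K \<union> R" y] by (simp add: E_def)
  have "x \<in> E"
  proof (rule E.fixed_by_embeddings_adjoin[OF m])
    show "x \<in> E.adjoin y" using insert.prems(2) by (simp add: adj)
  next
    fix \<psi> :: "'a \<Rightarrow> 'a"
    assume "field_hom_on (E.adjoin y) \<psi>" "\<And>u. u \<in> E \<Longrightarrow> \<psi> u = u"
    then show "\<psi> x = x" using insert.prems(3)[of \<psi>] KE by (auto simp: adj)
  qed
  then have xE: "x \<in> gen_field (K \<union> R)" by (simp add: E_def)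
  show ?case
  proof (rule insert.IH[OF _ xE])
    show "separable_over K z" if "z \<in> R" for z using insert.prems(1) that by simp
  next
    fix \<phi> :: "'a \<Rightarrow> 'a"
    assume "field_hom_on (gen_field (K \<union> R)) \<phi>" and K_fixed: "\<And>u. u \<in> K \<Longrightarrow> \<phi> u = u"
    then interpret \<phi>: field_hom_on E \<phi> by (simp add: E_def)
    \<comment> \<open>Here algebraic closedness enters: the transported minimal polynomial is
      nonconstant, so it has a root to which \<open>y\<close> can be sent.\<close>
    have "Polynomial.degree (map_poly \<phi> m) > 0"
      using \<phi>.map_poly_hom_degree[of m] E.minpoly_degree_pos[OF m(1)] m(1)
      by (simp add: E.minpoly_of_def)
    then obtain z where "poly (map_poly \<phi> m) z = 0"
      using alg_closed_imp_poly_has_root by blast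
    then obtain \<psi> where \<psi>: "field_hom_on (E.adjoin y) \<psi>" "\<And>u. u \<in> E \<Longrightarrow> \<psi> u = \<phi> u"
      using \<phi>.extend_to_adjoin[OF m(1)] by blast
    have "\<psi> u = u" if "u \<in> K" for u
      using \<psi>(2)[of u] KE K_fixed that by auto
    then have "\<psi> x = x"
      using \<psi>(1) by (intro insert.prems(3)) (simp_all add: adj)
    then show "\<phi> x = x" using \<psi>(2) \<open>x \<in> E\<close> by simp
  qed
qed

subsection \<open>Vandermonde systems and roots\<close>

text \<open>Newton interpolation: a new node is treated by adding a multiple of the product
  \<open>P\<close> that vanishes at all earlier nodes. The degree bound is phrased through
  coefficients so that it also covers empty \<open>I\<close>, where the polynomial is 0.\<close>

lemma (in field_subset) interpolation_exists:
  assumes "finite I" "inj_on \<alpha> I" "\<And>i. i \<in> I \<Longrightarrow> \<alpha> i \<in> K" "\<And>i. i \<in> I \<Longrightarrow> v i \<in> K"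
  shows "\<exists>p\<in>polys_over K. (\<forall>k\<ge>card I. Polynomial.coeff p k = 0) \<and> (\<forall>i\<in>I. poly p (\<alpha> i) = v i)"
  using assms
proof (induction I)
  case empty
  show ?case by (rule bexI[OF _ polys_0]) simp
next
  case (insert a I)
  then obtain p where p: "p \<in> polys_over K" "\<And>k. k \<ge> card I \<Longrightarrow> Polynomial.coeff p k = 0"
      "\<And>i. i \<in> I \<Longrightarrow> poly p (\<alpha> i) = v i"
    by auto
  define P where "P = (\<Prod>i\<in>I. [:- \<alpha> i, 1:])"
  define t where "t = (v a - poly p (\<alpha> a)) / poly P (\<alpha> a)"
  have P: "P \<in> polys_over K"
    unfolding P_def using insert.prems by (intro polys_prod polys_linear) (auto intro: mem_intros)
  have Pa: "poly P (\<alpha> a) \<noteq> 0"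
    using insert.hyps insert.prems by (auto simp: P_def poly_prod)
  have PI: "poly P (\<alpha> i) = 0" if "i \<in> I" for i
    using that insert.hyps(1) by (auto simp: P_def poly_prod)
  have "t \<in> K"
    unfolding t_def using insert.prems p(1) P by (intro mem_intros poly_mem) auto
  show ?case
  proof (intro bexI[of _ "p + Polynomial.smult t P"] conjI allI impI ballI)
    show "p + Polynomial.smult t P \<in> polys_over K"
      using p(1) P \<open>t \<in> K\<close> by (intro polys_add polys_smult)
    show "Polynomial.coeff (p + Polynomial.smult t P) k = 0" if "k \<ge> card (insert a I)" for k
      using that p(2)[of k] insert.hyps degree_prod_linear[of \<alpha> I]
      by (simp add: coeff_eq_0 flip: P_def)
    show "poly (p + Polynomial.smult t P) (\<alpha> i) = v i" if "i \<in> insert a I" for i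
      using that p(3) PI Pa by (auto simp: t_def)
  qed
qed

text \<open>The polynomials with coefficients \<open>c\<close> and \<open>d\<close> have degree
  below \<open>n\<close> and agree at \<open>n\<close> distinct points.\<close>

lemma vandermonde_unique:
  fixes \<alpha> :: "nat \<Rightarrow> 'a :: field"
  assumes inj: "inj_on \<alpha> {1..n}"
    and eq: "\<And>i. i \<in> {1..n} \<Longrightarrow> (\<Sum>l<n. c l * \<alpha> i ^ l) = (\<Sum>l<n. d l * \<alpha> i ^ l)"
    and "k < n"
  shows "c k = d k"
proof -
  define p where "p e = (\<Sum>l<n. Polynomial.monom (e l) l)" for e :: "nat \<Rightarrow> 'a"
  have "Polynomial.degree (p e) < card (\<alpha> ` {1..n})" for e
    unfolding p_def using \<open>k < n\<close> card_image[OF inj]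
    by (intro degree_sum_less) (auto intro: le_less_trans[OF degree_monom_le])
  then have "p c = p d"
    using eq by (intro poly_eqI_degree[where A = "\<alpha> ` {1..n}"])
      (auto simp: p_def poly_sum poly_monom)
  then have "Polynomial.coeff (p c) k = Polynomial.coeff (p d) k" by simp
  then show ?thesis using \<open>k < n\<close> by (simp add: p_def coeff_sum)
qed

text \<open>This resolves the definite description in \<open>vandermonde_sol\<close>: interpolation
  within \<open>K\<close> gives existence and \<open>vandermonde_unique\<close> uniqueness. Since
  the interpolating polynomial lies over \<open>K\<close>, its coefficients do so too.\<close>

lemma vandermonde_sol_mem:
  assumes "field_subset K" and inj: "inj_on \<alpha> {1..n}"
    and "\<And>i. i \<in> {1..n} \<Longrightarrow> \<alpha> i \<in> K" "\<And>i. i \<in> {1..n} \<Longrightarrow> \<beta> (\<tau> i) \<in> K"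
  shows "i \<in> {1..n} \<Longrightarrow> \<beta> (\<tau> i) = (\<Sum>l<n. vandermonde_sol n \<alpha> \<beta> \<tau> l * \<alpha> i ^ l)"
    and "l < n \<Longrightarrow> vandermonde_sol n \<alpha> \<beta> \<tau> l \<in> K"
proof -
  interpret field_subset K by fact
  define Q where "Q = (\<lambda>c. c \<in> extensional {..<n} \<and>
    (\<forall>i\<in>{1..n}. \<beta> (\<tau> i) = (\<Sum>l<n. c l * \<alpha> i ^ l)))"
  obtain p where p: "p \<in> polys_over K" "\<And>k. k \<ge> n \<Longrightarrow> Polynomial.coeff p k = 0"
      "\<And>i. i \<in> {1..n} \<Longrightarrow> poly p (\<alpha> i) = \<beta> (\<tau> i)"
    using interpolation_exists[of "{1..n}" \<alpha> "\<lambda>i. \<beta> (\<tau> i)"] assms by auto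
  \<comment> \<open>From index \<open>n\<close> on, the coefficient 0 is replaced by
    \<open>undefined\<close>, as \<open>extensional\<close> demands.\<close>
  define c where "c = restrict (Polynomial.coeff p) {..<n}"
  have "poly p x = (\<Sum>l<n. c l * x ^ l)" for x
  proof -
    have "poly p x = (\<Sum>l\<le>Polynomial.degree p. Polynomial.coeff p l * x ^ l)"
      by (rule poly_altdef)
    also have "\<dots> = (\<Sum>l\<in>{..Polynomial.degree p} \<union> {..<n}. Polynomial.coeff p l * x ^ l)"
      by (intro sum.mono_neutral_left) (auto simp: coeff_eq_0)
    also have "\<dots> = (\<Sum>l<n. Polynomial.coeff p l * x ^ l)"
      using p(2) by (intro sum.mono_neutral_right) auto
    finally show ?thesis by (simp add: c_def)
  qed
  then have c: "Q c" using p(3) by (auto simp: Q_def c_def)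
  moreover have "d = c" if "Q d" for d
  proof (rule extensionalityI[of _ "{..<n}"])
    show "d l = c l" if "l \<in> {..<n}" for l
    proof (rule vandermonde_unique[OF inj])
      show "(\<Sum>l<n. d l * \<alpha> i ^ l) = (\<Sum>l<n. c l * \<alpha> i ^ l)" if "i \<in> {1..n}" for i
        using c \<open>Q d\<close> that unfolding Q_def by metis
    qed (use that in simp)
  qed (use c that in \<open>simp_all add: Q_def\<close>)
  ultimately have "vandermonde_sol n \<alpha> \<beta> \<tau> = c"
    unfolding vandermonde_sol_def Q_def[symmetric] by (intro the_equality)
  moreover have "l < n \<Longrightarrow> c l \<in> K"
    using p(1) by (simp add: c_def polys_over_def)
  ultimately show "i \<in> {1..n} \<Longrightarrow> \<beta> (\<tau> i) = (\<Sum>l<n. vandermonde_sol n \<alpha> \<beta> \<tau> l * \<alpha> i ^ l)"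
      "l < n \<Longrightarrow> vandermonde_sol n \<alpha> \<beta> \<tau> l \<in> K"
    using c unfolding Q_def by metis+
qed

lemma field_subset_UNIV: "field_subset UNIV"
  by unfold_locales auto

lemma vandermonde_sol_eqI:
  assumes inj: "inj_on \<alpha> {1..n}"
    and "\<And>i. i \<in> {1..n} \<Longrightarrow> \<beta> (\<tau> i) = (\<Sum>l<n. c l * \<alpha> i ^ l)" and "l < n"
  shows "vandermonde_sol n \<alpha> \<beta> \<tau> l = c l"
proof (rule vandermonde_unique[OF inj _ \<open>l < n\<close>])
  fix i assume i: "i \<in> {1..n}"
  show "(\<Sum>l<n. vandermonde_sol n \<alpha> \<beta> \<tau> l * \<alpha> i ^ l) = (\<Sum>l<n. c l * \<alpha> i ^ l)"
    using vandermonde_sol_mem(1)[OF field_subset_UNIV inj UNIV_I UNIV_I i, of \<beta> \<tau>] assms(2)[OF i]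
    by simp
qed

text \<open>Applying \<open>\<phi>\<close> to the system for \<open>\<tau>\<close> gives a system
  with nodes \<open>\<alpha>' (s i)\<close> and unknowns the images of the coefficients. It is the
  system for \<open>\<tau>'\<close> with its equations reordered by \<open>s\<close>, so uniqueness
  identifies the solutions.\<close>

lemma (in field_hom_on) hom_vandermonde_sol:
  fixes \<alpha>' :: "nat \<Rightarrow> 'b"
  assumes inj: "inj_on \<alpha> {1..n}"
    and K: "\<And>i. i \<in> {1..n} \<Longrightarrow> \<alpha> i \<in> K" "\<And>i. i \<in> {1..n} \<Longrightarrow> \<beta> (\<tau> i) \<in> K"
    and inj': "inj_on \<alpha>' {1..n}"
    and s: "s permutes {1..n}"
    and \<phi>: "\<And>i. i \<in> {1..n} \<Longrightarrow> \<phi> (\<alpha> i) = \<alpha>' (s i)"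
      "\<And>i. i \<in> {1..n} \<Longrightarrow> \<phi> (\<beta> (\<tau> i)) = \<beta>' (\<tau>' (s i))"
    and "l < n"
  shows "\<phi> (vandermonde_sol n \<alpha> \<beta> \<tau> l) = vandermonde_sol n \<alpha>' \<beta>' \<tau>' l"
proof (rule vandermonde_sol_eqI[OF inj' _ \<open>l < n\<close>, symmetric])
  fix i assume i: "i \<in> {1..n}"
  let ?c = "vandermonde_sol n \<alpha> \<beta> \<tau>"
  obtain k where k: "k \<in> {1..n}" "s k = i"
    using i permutes_image[OF s] by (metis imageE)
  have sol: "\<beta> (\<tau> k) = (\<Sum>l<n. ?c l * \<alpha> k ^ l)" "\<And>l. l < n \<Longrightarrow> ?c l \<in> K"
    by (rule vandermonde_sol_mem[OF field_subset_axioms inj]; use K k in blast)+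
  have "\<beta>' (\<tau>' i) = \<phi> (\<Sum>l<n. ?c l * \<alpha> k ^ l)"
    using \<phi>(2)[OF k(1)] sol(1) k(2) by simp
  also have "\<dots> = (\<Sum>l<n. \<phi> (?c l) * \<phi> (\<alpha> k) ^ l)"
    using K(1)[OF k(1)] sol(2)
    by (subst hom_sum) (auto intro!: mult_mem power_mem simp: hom_mult hom_power power_mem)
  finally show "\<beta>' (\<tau>' i) = (\<Sum>l<n. \<phi> (?c l) * \<alpha>' i ^ l)"
    using \<phi>(1)[OF k(1)] k(2) by simp
qed

text \<open>Two indices with the same value contribute a squared linear factor. This serves both for
  the lists of roots and for the family of Vandermonde coefficients indexed by permutations.\<close>

lemma rsquarefree_prod_linear_inj_on:
  fixes f :: "'i \<Rightarrow> 'a :: field"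
  assumes sqf: "rsquarefree (\<Prod>i\<in>I. [:- f i, 1:])" and "finite I"
  shows "inj_on f I"
proof (rule inj_onI, rule ccontr)
  fix i j assume ij: "i \<in> I" "j \<in> I" "f i = f j" "i \<noteq> j"
  let ?P = "\<Prod>i\<in>I. [:- f i, 1:]"
  have "?P = [:- f i, 1:] * (\<Prod>i\<in>I - {i}. [:- f i, 1:])"
    using ij \<open>finite I\<close> by (simp only: prod.remove)
  also have "\<dots> = [:- f i, 1:] * ([:- f j, 1:] * (\<Prod>i\<in>I - {i} - {j}. [:- f i, 1:]))"
    using ij \<open>finite I\<close> prod.remove[of "I - {i}" j "\<lambda>i. [:- f i, 1:]"] by simp
  finally have "?P = [:- f i, 1:] ^ 2 * (\<Prod>i\<in>I - {i} - {j}. [:- f i, 1:])"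
    using ij(3) by (simp only: power2_eq_square mult.assoc)
  then have "[:- f i, 1:] ^ 2 dvd ?P" by (rule dvdI)
  then have "order (f i) ?P \<ge> 2"
    using prod_linear_nonzero[of f I] unfolding order_divides by blast
  moreover have "order (f i) ?P = 0 \<or> order (f i) ?P = 1"
    using sqf unfolding rsquarefree_def by blast
  ultimately show False by linarith
qed

section \<open>Root sets in the algebraic closure and embeddings acting on them\<close>

lemma roots_in_closure_lists_roots:
  assumes "lists_roots n f \<alpha>"
  shows "roots_in_closure f = \<alpha> ` {1..n}"
  using assms by (auto simp: roots_in_closure_def lists_roots_def poly_prod)

lemma field_subset_range_to_ac: "field_subset (range to_ac)"
proof
  fix x y :: "'a alg_closure" assume "x \<in> range to_ac" "y \<in> range to_ac"
  then obtain u v where "x = to_ac u" "y = to_ac v" by auto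
  then show "x - y \<in> range to_ac" "x * y \<in> range to_ac"
    by (auto simp flip: to_ac_diff to_ac_mult)
next
  show "1 \<in> range to_ac" by (rule range_eqI[of _ _ 1]) simp
  show "inverse x \<in> range to_ac" if "x \<in> range to_ac" for x :: "'a alg_closure"
    using that by (auto simp flip: to_ac_inverse)
qed

lemma map_poly_to_ac_polys_over: "map_poly to_ac f \<in> polys_over (range to_ac)"
  by (simp add: polys_over_def coeff_map_poly)

lemma separable_over_lists_roots:
  assumes "lists_roots n f \<alpha>" "inj_on \<alpha> {1..n}" "y \<in> \<alpha> ` {1..n}"
  shows "separable_over (range to_ac) y"
proof -
  have "(\<Prod>s\<in>\<alpha> ` {1..n}. [:- s, 1:]) = map_poly to_ac f"
    using assms(1,2) by (simp add: lists_roots_def prod.reindex)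
  then show ?thesis
    unfolding separable_over_def using assms(3) map_poly_to_ac_polys_over[of f]
    by (intro exI[of _ "\<alpha> ` {1..n}"]) auto
qed

text \<open>Conjugation by \<open>\<alpha>\<close> turns a permutation of root values into one of
  indices. It is continued by the identity outside \<open>I\<close>, as \<open>permutes\<close>
  requires.\<close>

lemma bij_betw_lift_permutes:
  assumes "bij_betw \<phi> (\<alpha> ` I) (\<alpha> ` I)" "inj_on \<alpha> I"
  obtains s where "s permutes I" "\<And>i. i \<in> I \<Longrightarrow> \<phi> (\<alpha> i) = \<alpha> (s i)"
proof -
  define s where "s i = (if i \<in> I then inv_into I \<alpha> (\<phi> (\<alpha> i)) else i)" for i
  have \<alpha>: "bij_betw \<alpha> I (\<alpha> ` I)" using assms(2) by (simp add: bij_betw_def)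
  have "bij_betw (inv_into I \<alpha> \<circ> (\<phi> \<circ> \<alpha>)) I I"
    using \<alpha> assms(1) bij_betw_inv_into[OF \<alpha>] by (blast intro: bij_betw_trans)
  then have "bij_betw s I I"
    by (rule bij_betw_cong[THEN iffD1, rotated]) (simp add: s_def)
  then have "s permutes I" by (rule bij_imp_permutes) (simp add: s_def)
  moreover have "\<phi> (\<alpha> i) = \<alpha> (s i)" if "i \<in> I" for i
    using that bij_betwE[OF assms(1)] by (simp add: s_def f_inv_into_f)
  ultimately show ?thesis by (rule that)
qed

text \<open>These are the embeddings of \<open>L\<close> over M into the algebraic closure; the
  image may differ from \<open>L\<close>.\<close>

locale embedding_over_base = field_hom_on L \<phi>
  for L :: "'m :: field alg_closure set" and \<phi> :: "'m alg_closure \<Rightarrow> 'm alg_closure" +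
  assumes base_subset: "range to_ac \<subseteq> L"
    and base_fixed: "\<phi> (to_ac x) = to_ac x"
begin

text \<open>The coefficients of \<open>f\<close> are fixed, so roots go to roots, and an injective
  self-map of a finite set is bijective.\<close>

lemma bij_betw_roots:
  assumes "f \<noteq> 0" "roots_in_closure f \<subseteq> L"
  shows "bij_betw \<phi> (roots_in_closure f) (roots_in_closure f)"
proof -
  let ?F = "map_poly to_ac f"
  have "?F \<noteq> 0" using assms(1) by (simp add: map_poly_eq_0_iff)
  then have fin: "finite (roots_in_closure f)"
    unfolding roots_in_closure_def by (rule poly_roots_finite)
  have inj: "inj_on \<phi> (roots_in_closure f)"
    using hom_inj assms(2) by (rule inj_on_subset)
  have "map_poly \<phi> ?F = ?F"
    by (rule poly_eqI) (simp add: coeff_map_poly hom_zero base_fixed)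
  moreover have "?F \<in> polys_over L"
    using map_poly_to_ac_polys_over polys_over_mono[OF base_subset] by blast
  ultimately have "\<phi> ` roots_in_closure f \<subseteq> roots_in_closure f"
    using assms(2) hom_poly[of ?F] hom_zero by (fastforce simp: roots_in_closure_def)
  with fin inj show ?thesis by (simp add: bij_betw_def endo_inj_surj)
qed

end

subsection \<open>Galois groups and stabilizers\<close>

text \<open>The conjugacy hypothesis concerns a permutation group, whereas the stabilizers of roots
  live in a Galois group; this transports it. An isomorphism induces a bijection on cosets, so the
  index is preserved, and the conjugating element is pulled back.\<close>

lemma index_subgroups_conjugate_iso:
  assumes G: "group G" and H: "group H" and h: "h \<in> iso G H"
    and conj: "index_subgroups_conjugate H n"
  shows "index_subgroups_conjugate G n"
proof -
  interpret G: group G by fact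
  interpret H: group H by fact
  interpret h: group_hom G H h
    using h by unfold_locales (auto simp: iso_def)
  have inj: "inj_on h (carrier G)" and surj: "h ` carrier G = carrier H"
    using h by (auto simp: iso_def bij_betw_def)
  have index: "card (rcosets\<^bsub>H\<^esub> (h ` A)) = card (rcosets\<^bsub>G\<^esub> A)" if A: "subgroup A G" for A
  proof -
    have coset: "h ` (A #>\<^bsub>G\<^esub> x) = h ` A #>\<^bsub>H\<^esub> h x" if "x \<in> carrier G" for x
      unfolding r_coset_def image_UN SUP_image comp_def
      using that subgroup.mem_carrier[OF A] by (intro SUP_cong refl) simp
    have "rcosets\<^bsub>H\<^esub> (h ` A) = (\<lambda>C. h ` C) ` (rcosets\<^bsub>G\<^esub> A)"
      unfolding RCOSETS_def surj[symmetric] image_UN SUP_image comp_def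
      by (intro SUP_cong refl) (simp add: coset)
    \<comment> \<open>Cosets are subsets of the carrier, on which \<open>h\<close> is injective, so
      taking images is injective on them.\<close>
    moreover have "inj_on (\<lambda>C. h ` C) (rcosets\<^bsub>G\<^esub> A)"
      using subset_Pow_Union[of "rcosets\<^bsub>G\<^esub> A"]
      unfolding G.rcosets_part_G[OF A] by (rule inj_on_subset[OF inj_on_image_Pow[OF inj]])
    ultimately show ?thesis by (simp add: card_image)
  qed
  show ?thesis
    unfolding index_subgroups_conjugate_def
  proof (intro allI impI, elim conjE)
    fix A B
    assume A: "subgroup A G" "card (rcosets\<^bsub>G\<^esub> A) = n" and B: "subgroup B G" "card (rcosets\<^bsub>G\<^esub> B) = n"
    have "subgroup (h ` A) H \<and> card (rcosets\<^bsub>H\<^esub> (h ` A)) = n \<and>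
        subgroup (h ` B) H \<and> card (rcosets\<^bsub>H\<^esub> (h ` B)) = n"
      using index[OF A(1)] index[OF B(1)] A B h.subgroup_img_is_subgroup by simp
    then have "\<exists>k\<in>carrier H. h ` B = (\<lambda>x. k \<otimes>\<^bsub>H\<^esub> x \<otimes>\<^bsub>H\<^esub> inv\<^bsub>H\<^esub> k) ` h ` A"
      by (rule conj[unfolded index_subgroups_conjugate_def, rule_format])
    then obtain k where k: "k \<in> carrier H" "h ` B = (\<lambda>x. k \<otimes>\<^bsub>H\<^esub> x \<otimes>\<^bsub>H\<^esub> inv\<^bsub>H\<^esub> k) ` h ` A"
      ..
    from k(1) obtain g where g: "g \<in> carrier G" "k = h g"
      unfolding surj[symmetric] by blast
    let ?C = "(\<lambda>x. g \<otimes>\<^bsub>G\<^esub> x \<otimes>\<^bsub>G\<^esub> inv\<^bsub>G\<^esub> g) ` A"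
    have "h ` B = h ` ?C"
      unfolding k(2) image_image using subgroup.subset[OF A(1)] g
      by (intro image_cong) auto
    moreover have "B \<subseteq> carrier G" "?C \<subseteq> carrier G"
      using subgroup.subset[OF A(1)] subgroup.subset[OF B(1)] g(1) by auto
    ultimately have "B = ?C"
      using inj_on_image_eq_iff[OF inj, of B ?C] by simp
    then show "\<exists>g\<in>carrier G. B = (\<lambda>x. g \<otimes>\<^bsub>G\<^esub> x \<otimes>\<^bsub>G\<^esub> inv\<^bsub>G\<^esub> g) ` A"
      using g(1) by blast
  qed
qed

lemma (in group_action) image_eq_iff:
  assumes "g \<in> carrier G" "x \<in> E" "y \<in> E"
  shows "\<phi> (inv g) y = x \<longleftrightarrow> y = \<phi> g x"
proof
  interpret group G using group_hom group_hom.axioms(1) by auto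
  assume "\<phi> (inv g) y = x"
  from orbit_sym_aux[OF inv_closed[OF assms(1)] assms(3) this] assms(1)
  show "y = \<phi> g x" by simp
next
  assume "y = \<phi> g x"
  from orbit_sym_aux[OF assms(1,2) this[symmetric]] show "\<phi> (inv g) y = x" .
qed

text \<open>The stabilizer of \<open>\<phi> g x\<close> is the conjugate of that of \<open>x\<close>
  by \<open>g\<close>, which is the stabilizer of \<open>y\<close>. Whether \<open>s\<close> and
  \<open>t\<close> agree at a point depends only on whether \<open>inv t \<otimes> s\<close>
  stabilizes it.\<close>

lemma (in group_action) conjugate_stabilizers_equivariant:
  assumes x: "x \<in> E" and y: "y \<in> E" and g: "g \<in> carrier G"
    and conj: "stabilizer G \<phi> y = (\<lambda>h. g \<otimes> h \<otimes> inv g) ` stabilizer G \<phi> x"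
    and s: "s \<in> carrier G" and t: "t \<in> carrier G"
  shows "\<phi> s (\<phi> g x) = \<phi> t (\<phi> g x) \<longleftrightarrow> \<phi> s y = \<phi> t y"
proof -
  interpret group G using group_hom group_hom.axioms(1) by auto
  have mem: "\<phi> h z \<in> E" if "h \<in> carrier G" "z \<in> E" for h z
    using element_image[OF that refl] .
  have shift: "\<phi> s z = \<phi> t z \<longleftrightarrow> \<phi> (inv t \<otimes> s) z = z" if z: "z \<in> E" for z
    unfolding composition_rule[OF z inv_closed[OF t] s]
      image_eq_iff[OF t z mem[OF s z]] ..
  define d where "d = inv t \<otimes> s"
  have d: "d \<in> carrier G" using s t by (simp add: d_def)
  have cancel: "g \<otimes> (inv g \<otimes> z) = z" "inv g \<otimes> (g \<otimes> z) = z" if "z \<in> carrier G" for z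
    using that g by (simp_all flip: m_assoc)
  have gx: "\<phi> g x \<in> E" by (rule mem[OF g x])
  have dg: "d \<otimes> g \<in> carrier G" using d g by simp
  have "\<phi> d (\<phi> g x) = \<phi> g x \<longleftrightarrow> \<phi> (inv g \<otimes> (d \<otimes> g)) x = x"
    unfolding composition_rule[OF x inv_closed[OF g] dg] image_eq_iff[OF g x mem[OF d gx]]
      composition_rule[OF x d g] ..
  also have "\<dots> \<longleftrightarrow> inv g \<otimes> (d \<otimes> g) \<in> stabilizer G \<phi> x"
    using dg g by (simp add: stabilizer_def)
  also have "\<dots> \<longleftrightarrow> d \<in> stabilizer G \<phi> y"
  proof
    assume "inv g \<otimes> (d \<otimes> g) \<in> stabilizer G \<phi> x"
    moreover have "d = g \<otimes> (inv g \<otimes> (d \<otimes> g)) \<otimes> inv g"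
      using d g by (simp add: m_assoc cancel)
    ultimately show "d \<in> stabilizer G \<phi> y" unfolding conj by blast
  next
    assume "d \<in> stabilizer G \<phi> y"
    then obtain h where h: "h \<in> stabilizer G \<phi> x" "d = g \<otimes> h \<otimes> inv g"
      unfolding conj by blast
    then have "h \<in> carrier G" by (simp add: stabilizer_def)
    then have "inv g \<otimes> (d \<otimes> g) = h"
      unfolding h(2) using g by (simp add: m_assoc cancel)
    with h(1) show "inv g \<otimes> (d \<otimes> g) \<in> stabilizer G \<phi> x" by simp
  qed
  also have "\<dots> \<longleftrightarrow> \<phi> d y = y" using d by (simp add: stabilizer_def)
  finally show ?thesis using shift[OF gx] shift[OF y] unfolding d_def by blast
qed

section \<open>The Galois group as a group acting on the field\<close>

lemma embedding_over_base_restrict: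
  assumes "embedding_over_base L \<phi>"
  shows "embedding_over_base L (restrict \<phi> L)"
proof -
  interpret embedding_over_base L \<phi> by fact
  show ?thesis
    using base_subset base_fixed
    by unfold_locales (auto simp: mem_intros hom_one hom_diff hom_mult)
qed

text \<open>Passage from the record homomorphisms in \<open>Gal\<close> to
  \<open>embedding_over_base\<close>, so that the facts about embeddings apply to
  automorphisms.\<close>

lemma carrier_Gal_iff:
  assumes L: "field_subset L" and base: "range to_ac \<subseteq> L"
  shows "\<sigma> \<in> carrier (Gal L) \<longleftrightarrow> \<sigma> \<in> Bij L \<and> embedding_over_base L \<sigma>"
proof
  interpret L: field_subset L by fact
  assume \<sigma>: "\<sigma> \<in> carrier (Gal L)"
  then have add: "\<And>x y. x \<in> L \<Longrightarrow> y \<in> L \<Longrightarrow> \<sigma> (x + y) = \<sigma> x + \<sigma> y"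
    and mult: "\<And>x y. x \<in> L \<Longrightarrow> y \<in> L \<Longrightarrow> \<sigma> (x * y) = \<sigma> x * \<sigma> y"
    and one: "\<sigma> 1 = 1"
    by (auto simp: Gal_def ring_hom_def ring_of_type_algebra_def)
  have "\<sigma> (x - y) = \<sigma> x - \<sigma> y" if "x \<in> L" "y \<in> L" for x y
    using add[of "x - y" y] that by (simp add: L.diff_mem)
  then have "embedding_over_base L \<sigma>"
    using \<sigma> base mult one by unfold_locales (auto simp: Gal_def)
  moreover have "\<sigma> \<in> Bij L" using \<sigma> by (simp add: Gal_def)
  ultimately show "\<sigma> \<in> Bij L \<and> embedding_over_base L \<sigma>" by simp
next
  assume \<sigma>: "\<sigma> \<in> Bij L \<and> embedding_over_base L \<sigma>"
  then interpret embedding_over_base L \<sigma> by blast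
  show "\<sigma> \<in> carrier (Gal L)"
    using \<sigma> Bij_imp_funcset[of \<sigma> L] base_fixed
    by (auto simp: Gal_def ring_hom_def ring_of_type_algebra_def hom_add hom_mult hom_one)
qed

text \<open>Group elements are themselves bijections of \<open>L\<close>, so the action is
  \<open>\<lambda>\<sigma>. \<sigma>\<close>. The substance is that the automorphisms over M form a
  subgroup of \<open>BijGroup L\<close>.\<close>

lemma group_action_Gal:
  assumes L: "field_subset L" and base: "range to_ac \<subseteq> L"
  shows "group_action (Gal L) L (\<lambda>\<sigma>. \<sigma>)"
proof -
  interpret L: field_subset L by fact
  interpret B: group "BijGroup L" by (rule group_BijGroup)
  have "subgroup (carrier (Gal L)) (BijGroup L)"
  proof
    show "carrier (Gal L) \<subseteq> carrier (BijGroup L)" by (auto simp: Gal_def BijGroup_def)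
  next
    have "embedding_over_base L (\<lambda>x\<in>L. x)"
      using base by unfold_locales (auto intro: L.mem_intros)
    then show "\<one>\<^bsub>BijGroup L\<^esub> \<in> carrier (Gal L)"
      by (simp add: carrier_Gal_iff[OF assms] BijGroup_def id_Bij)
  next
    fix \<sigma> \<tau> assume "\<sigma> \<in> carrier (Gal L)" "\<tau> \<in> carrier (Gal L)"
    then have bij: "\<sigma> \<in> Bij L" "\<tau> \<in> Bij L"
      and emb: "embedding_over_base L \<sigma>" "embedding_over_base L \<tau>"
      by (auto simp: carrier_Gal_iff[OF assms])
    interpret \<sigma>: embedding_over_base L \<sigma> by fact
    interpret \<tau>: embedding_over_base L \<tau> by fact
    have "embedding_over_base L (compose L \<sigma> \<tau>)"
      using base Bij_imp_funcset[OF bij(2)]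
      by unfold_locales
        (auto simp: compose_eq L.mem_intros \<tau>.hom_one \<sigma>.hom_one \<tau>.hom_diff \<sigma>.hom_diff
          \<tau>.hom_mult \<sigma>.hom_mult \<tau>.base_fixed \<sigma>.base_fixed Pi_iff subset_iff)
    then show "\<sigma> \<otimes>\<^bsub>BijGroup L\<^esub> \<tau> \<in> carrier (Gal L)"
      using bij by (simp add: carrier_Gal_iff[OF assms] BijGroup_def compose_Bij)
  next
    fix \<sigma> assume "\<sigma> \<in> carrier (Gal L)"
    then have bij: "\<sigma> \<in> Bij L" and emb: "embedding_over_base L \<sigma>"
      by (auto simp: carrier_Gal_iff[OF assms])
    interpret \<sigma>: embedding_over_base L \<sigma> by fact
    let ?\<tau> = "restrict (inv_into L \<sigma>) L"
    have \<tau>: "?\<tau> (\<sigma> x) = x" if "x \<in> L" for x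
      using that bij by (auto simp: Bij_def bij_betw_def)
    have surj: "\<exists>x\<in>L. u = \<sigma> x" if "u \<in> L" for u
      using that bij by (auto simp: Bij_def bij_betw_def image_iff)
    have "embedding_over_base L ?\<tau>"
    proof
      show "?\<tau> 1 = 1" using \<tau>[OF L.one_mem] by (simp only: \<sigma>.hom_one)
    next
      fix u v assume "u \<in> L" "v \<in> L"
      then obtain x y where xy: "x \<in> L" "y \<in> L" "u = \<sigma> x" "v = \<sigma> y" using surj by blast
      show "?\<tau> (u - v) = ?\<tau> u - ?\<tau> v"
        using \<tau>[OF L.diff_mem[OF xy(1,2)]] \<tau>[OF xy(1)] \<tau>[OF xy(2)] xy
        by (simp only: \<sigma>.hom_diff)
      show "?\<tau> (u * v) = ?\<tau> u * ?\<tau> v"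
        using \<tau>[OF L.mult_mem[OF xy(1,2)]] \<tau>[OF xy(1)] \<tau>[OF xy(2)] xy
        by (simp only: \<sigma>.hom_mult)
    next
      show "range to_ac \<subseteq> L" by fact
      show "?\<tau> (to_ac x) = to_ac x" for x
        using \<tau>[of "to_ac x"] base \<sigma>.base_fixed[of x] by (metis range_subsetD)
    qed
    then show "inv\<^bsub>BijGroup L\<^esub> \<sigma> \<in> carrier (Gal L)"
      using bij by (simp add: carrier_Gal_iff[OF assms] inv_BijGroup restrict_inv_into_Bij)
  qed
  then have "group (BijGroup L \<lparr>carrier := carrier (Gal L)\<rparr>)"
    by (rule subgroup.subgroup_is_group) (rule group_BijGroup)
  then have "group (Gal L)" by (simp add: Gal_def)
  moreover have "(\<lambda>\<sigma>. \<sigma>) \<in> hom (Gal L) (BijGroup L)"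
    by (auto simp: hom_def Gal_def BijGroup_def)
  ultimately show ?thesis
    unfolding group_action_def group_hom_def group_hom_axioms_def
    using group_BijGroup by blast
qed

section \<open>Splitting fields: normality and the orbit of a root\<close>

lemma Spl_eq: "Spl f = gen_field (range to_ac \<union> roots_in_closure f)"
  by (simp add: Spl_def)

lemma base_subset_Spl: "range to_ac \<subseteq> Spl f"
  unfolding Spl_eq using subset_gen_field[of "range to_ac \<union> roots_in_closure f"] by simp

lemma roots_subset_Spl: "roots_in_closure f \<subseteq> Spl f"
  unfolding Spl_eq using subset_gen_field[of "range to_ac \<union> roots_in_closure f"] by simp

lemma field_subset_Spl: "field_subset (Spl f)"
  unfolding Spl_eq by (rule field_subset_gen_field)

lemma (in field_hom_on) field_subset_image: "field_subset (\<phi> ` K)"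
proof
  show "1 \<in> \<phi> ` K" using imageI[OF one_mem, of \<phi>] by (simp add: hom_one)
next
  fix x y assume "x \<in> \<phi> ` K" "y \<in> \<phi> ` K"
  then obtain u v where uv: "u \<in> K" "v \<in> K" "x = \<phi> u" "y = \<phi> v" by blast
  show "x - y \<in> \<phi> ` K"
    unfolding uv hom_diff[OF uv(1,2), symmetric] using uv by (intro imageI diff_mem)
  show "x * y \<in> \<phi> ` K"
    unfolding uv hom_mult[OF uv(1,2), symmetric] using uv by (intro imageI mult_mem)
next
  fix x assume "x \<in> \<phi> ` K"
  then obtain u where u: "u \<in> K" "x = \<phi> u" by blast
  show "inverse x \<in> \<phi> ` K"
    unfolding u hom_inverse[OF u(1), symmetric] using u by (intro imageI inverse_mem)
qed

text \<open>Normality of a splitting field. An embedding permutes the roots and fixes M, so its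
  image is a field containing the generators of \<open>Spl f\<close>, which gives
  surjectivity.\<close>

lemma embedding_Spl_in_Gal:
  assumes "embedding_over_base (Spl f) \<phi>" and "f \<noteq> 0"
  shows "restrict \<phi> (Spl f) \<in> carrier (Gal (Spl f))"
proof -
  interpret embedding_over_base "Spl f" \<phi> by fact
  have bij: "bij_betw \<phi> (roots_in_closure f) (roots_in_closure f)"
    using assms(2) roots_subset_Spl by (rule bij_betw_roots)
  have base: "to_ac x \<in> \<phi> ` Spl f" for x
    using base_fixed[of x] base_subset by (metis image_eqI range_subsetD)
  have 1: "Spl f \<subseteq> \<phi> ` Spl f"
    unfolding Spl_eq[of f]
  proof (rule gen_field_least; fold Spl_eq)
    show "range to_ac \<union> roots_in_closure f \<subseteq> \<phi> ` Spl f"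
      using base bij_betw_imp_surj_on[OF bij] roots_subset_Spl[of f] by blast
  qed (rule field_subset_image)
  \<comment> \<open>That \<open>\<phi>\<close> maps \<open>Spl f\<close> into itself follows by
    minimality again: \<open>E\<close> is a field containing the generators.\<close>
  define E where "E = {x \<in> Spl f. \<phi> x \<in> Spl f}"
  have "field_subset E"
    by unfold_locales (auto simp: E_def mem_intros hom_one hom_diff hom_mult hom_inverse)
  moreover have "range to_ac \<union> roots_in_closure f \<subseteq> E"
    using base_subset base_fixed bij_betw_imp_surj_on[OF bij] roots_subset_Spl[of f]
    by (auto simp: E_def)
  ultimately have "Spl f \<subseteq> E"
    unfolding Spl_eq by (rule gen_field_least)
  with 1 have "bij_betw \<phi> (Spl f) (Spl f)"
    using hom_inj by (auto simp: bij_betw_def E_def)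
  then have "restrict \<phi> (Spl f) \<in> Bij (Spl f)"
    by (simp add: Bij_def bij_betw_restrict_eq)
  then show ?thesis
    using carrier_Gal_iff[OF field_subset_Spl base_subset_Spl]
      embedding_over_base_restrict[OF assms(1)] by blast
qed

text \<open>Cosets of a stabilizer correspond to points of the orbit, and transitivity makes the
  orbit the whole set of \<open>n\<close> roots.\<close>

lemma card_rcosets_stabilizer_root:
  assumes lists: "lists_roots n f \<alpha>" and inj: "inj_on \<alpha> {1..n}" and "f \<noteq> 0"
    and trans: "Gal_transitive_on_roots f" and i: "i \<in> {1..n}"
  shows "card (rcosets\<^bsub>Gal (Spl f)\<^esub> stabilizer (Gal (Spl f)) (\<lambda>\<sigma>. \<sigma>) (\<alpha> i)) = n"
proof -
  let ?\<Gamma> = "Gal (Spl f)"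
  note roots = roots_in_closure_lists_roots[OF lists]
  interpret action: group_action ?\<Gamma> "Spl f" "\<lambda>\<sigma>. \<sigma>"
    by (rule group_action_Gal[OF field_subset_Spl base_subset_Spl])
  have "orbit ?\<Gamma> (\<lambda>\<sigma>. \<sigma>) (\<alpha> i) = \<alpha> ` {1..n}"
  proof
    show "\<alpha> ` {1..n} \<subseteq> orbit ?\<Gamma> (\<lambda>\<sigma>. \<sigma>) (\<alpha> i)"
    proof
      fix z assume "z \<in> \<alpha> ` {1..n}"
      then obtain \<sigma> where "\<sigma> \<in> carrier ?\<Gamma>" "\<sigma> (\<alpha> i) = z"
        using trans imageI[OF i, of \<alpha>] unfolding Gal_transitive_on_roots_def roots by blast
      then show "z \<in> orbit ?\<Gamma> (\<lambda>\<sigma>. \<sigma>) (\<alpha> i)" unfolding orbit_def by blast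
    qed
    show "orbit ?\<Gamma> (\<lambda>\<sigma>. \<sigma>) (\<alpha> i) \<subseteq> \<alpha> ` {1..n}"
    proof
      fix z assume "z \<in> orbit ?\<Gamma> (\<lambda>\<sigma>. \<sigma>) (\<alpha> i)"
      then obtain \<sigma> where \<sigma>: "\<sigma> \<in> carrier ?\<Gamma>" "z = \<sigma> (\<alpha> i)" by (auto simp: orbit_def)
      then interpret embedding_over_base "Spl f" \<sigma>
        using carrier_Gal_iff[OF field_subset_Spl base_subset_Spl] by blast
      show "z \<in> \<alpha> ` {1..n}"
        using bij_betwE[OF bij_betw_roots[OF \<open>f \<noteq> 0\<close> roots_subset_Spl]] i \<sigma>(2)
        unfolding roots by blast
    qed
  qed
  moreover have "\<alpha> i \<in> Spl f"
    using roots_subset_Spl[of f] i unfolding roots by blast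
  ultimately show ?thesis
    using bij_betw_same_card[OF action.orbit_stab_fun_is_bij] card_image[OF inj] by simp
qed

subsection \<open>Equivariant permutations of the roots\<close>

lemma poly_nonzero_if_lists_roots: "lists_roots n f \<alpha> \<Longrightarrow> f \<noteq> 0"
  using prod_linear_nonzero[of \<alpha> "{1..n}"] by (auto simp: lists_roots_def)

text \<open>The two polynomials enter symmetrically, so that facts can be reused with their roles
  exchanged.\<close>

locale root_pair =
  fixes n :: nat and f g :: "'m :: field poly" and \<alpha> \<beta> :: "nat \<Rightarrow> 'm alg_closure"
  assumes lists_f: "lists_roots n f \<alpha>" and lists_g: "lists_roots n g \<beta>"
    and inj_\<alpha>: "inj_on \<alpha> {1..n}" and inj_\<beta>: "inj_on \<beta> {1..n}"
begin

text \<open>The splitting field of \<open>f * g\<close>. It contains all the Vandermonde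
  coefficients, and its embeddings act on both root sets at once.\<close>

definition compositum :: "'m alg_closure set" where
  "compositum = gen_field (range to_ac \<union> (roots_in_closure f \<union> roots_in_closure g))"

lemmas roots_f = roots_in_closure_lists_roots[OF lists_f]
lemmas roots_g = roots_in_closure_lists_roots[OF lists_g]

lemma field_subset_compositum: "field_subset compositum"
  unfolding compositum_def by (rule field_subset_gen_field)

lemma compositum_supset:
  "range to_ac \<subseteq> compositum" "roots_in_closure f \<subseteq> compositum" "roots_in_closure g \<subseteq> compositum"
  using subset_gen_field[of "range to_ac \<union> (roots_in_closure f \<union> roots_in_closure g)"]
  by (simp_all add: compositum_def)

lemma root_mem_compositum: "i \<in> {1..n} \<Longrightarrow> \<alpha> i \<in> compositum" "i \<in> {1..n} \<Longrightarrow> \<beta> i \<in> compositum"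
  using compositum_supset(2,3) by (auto simp: roots_f roots_g)

lemma embedding_permutes_roots:
  assumes "embedding_over_base compositum \<phi>"
  obtains s t where "s permutes {1..n}" "\<And>i. i \<in> {1..n} \<Longrightarrow> \<phi> (\<alpha> i) = \<alpha> (s i)"
    "t permutes {1..n}" "\<And>i. i \<in> {1..n} \<Longrightarrow> \<phi> (\<beta> i) = \<beta> (t i)"
proof -
  interpret embedding_over_base compositum \<phi> by fact
  have "bij_betw \<phi> (\<alpha> ` {1..n}) (\<alpha> ` {1..n})" "bij_betw \<phi> (\<beta> ` {1..n}) (\<beta> ` {1..n})"
    using bij_betw_roots[of f] bij_betw_roots[of g] compositum_supset(2,3)
      poly_nonzero_if_lists_roots[OF lists_f] poly_nonzero_if_lists_roots[OF lists_g]
    by (simp_all add: roots_f roots_g)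
  then show ?thesis
    using bij_betw_lift_permutes[OF _ inj_\<alpha>] bij_betw_lift_permutes[OF _ inj_\<beta>] that by metis
qed

lemma vandermonde_sol_compositum:
  assumes "\<tau> permutes {1..n}"
  shows "l < n \<Longrightarrow> vandermonde_sol n \<alpha> \<beta> \<tau> l \<in> compositum"
  by (rule vandermonde_sol_mem(2)[OF field_subset_compositum inj_\<alpha>])
     (use permutes_in_image[OF assms] in \<open>simp_all add: root_mem_compositum\<close>)

text \<open>The condition \<open>t \<circ> \<tau> = \<tau>' \<circ> s\<close> says that
  \<open>\<tau>'\<close> is \<open>\<tau>\<close> transported by \<open>s\<close> and
  \<open>t\<close>, without mentioning an inverse.\<close>

lemma embedding_vandermonde_sol:
  assumes \<phi>: "embedding_over_base compositum \<phi>"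
    and s: "s permutes {1..n}" "\<And>i. i \<in> {1..n} \<Longrightarrow> \<phi> (\<alpha> i) = \<alpha> (s i)"
    and t: "\<And>i. i \<in> {1..n} \<Longrightarrow> \<phi> (\<beta> i) = \<beta> (t i)"
    and \<tau>: "\<tau> permutes {1..n}" and \<tau>': "t \<circ> \<tau> = \<tau>' \<circ> s" and "l < n"
  shows "\<phi> (vandermonde_sol n \<alpha> \<beta> \<tau> l) = vandermonde_sol n \<alpha> \<beta> \<tau>' l"
proof -
  interpret embedding_over_base compositum \<phi> by fact
  show ?thesis
  proof (rule hom_vandermonde_sol[OF inj_\<alpha> _ _ inj_\<alpha> s(1) _ _ \<open>l < n\<close>])
    fix i assume i: "i \<in> {1..n}"
    then have \<tau>i: "\<tau> i \<in> {1..n}" using permutes_in_image[OF \<tau>] by simp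
    show "\<alpha> i \<in> compositum" "\<beta> (\<tau> i) \<in> compositum" "\<phi> (\<alpha> i) = \<alpha> (s i)"
      using root_mem_compositum i \<tau>i s(2) by simp_all
    show "\<phi> (\<beta> (\<tau> i)) = \<beta> (\<tau>' (s i))"
      using t[OF \<tau>i] fun_cong[OF \<tau>', of i] by simp
  qed
qed

text \<open>For equivariant \<open>\<tau>\<close> the transported permutation is
  \<open>\<tau>\<close> itself, so each embedding fixes the coefficients.\<close>

lemma coefficients_in_base:
  assumes \<tau>: "\<tau> permutes {1..n}"
    and equivariant: "\<And>\<phi> s t. embedding_over_base compositum \<phi> \<Longrightarrow>
        s permutes {1..n} \<Longrightarrow> (\<And>i. i \<in> {1..n} \<Longrightarrow> \<phi> (\<alpha> i) = \<alpha> (s i)) \<Longrightarrow>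
        t permutes {1..n} \<Longrightarrow> (\<And>i. i \<in> {1..n} \<Longrightarrow> \<phi> (\<beta> i) = \<beta> (t i)) \<Longrightarrow> t \<circ> \<tau> = \<tau> \<circ> s"
    and "l < n"
  shows "vandermonde_sol n \<alpha> \<beta> \<tau> l \<in> range to_ac"
proof (rule fixed_by_embeddings[OF field_subset_range_to_ac])
  show "finite (roots_in_closure f \<union> roots_in_closure g)"
    by (simp add: roots_f roots_g)
  show "separable_over (range to_ac) y" if "y \<in> roots_in_closure f \<union> roots_in_closure g" for y
    using that separable_over_lists_roots[OF lists_f inj_\<alpha>, of y]
      separable_over_lists_roots[OF lists_g inj_\<beta>, of y]
    by (auto simp: roots_f roots_g)
  show "vandermonde_sol n \<alpha> \<beta> \<tau> l \<in>
      gen_field (range to_ac \<union> (roots_in_closure f \<union> roots_in_closure g))"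
    using vandermonde_sol_compositum[OF \<tau> \<open>l < n\<close>] by (simp add: compositum_def)
next
  fix \<phi> :: "'m alg_closure \<Rightarrow> 'm alg_closure"
  assume hom: "field_hom_on (gen_field (range to_ac \<union> (roots_in_closure f \<union> roots_in_closure g))) \<phi>"
    and fixed: "\<And>u. u \<in> range to_ac \<Longrightarrow> \<phi> u = u"
  have \<phi>: "embedding_over_base compositum \<phi>"
    unfolding embedding_over_base_def embedding_over_base_axioms_def
    using hom fixed compositum_supset(1) by (simp add: compositum_def)
  from \<phi> obtain s t where st: "s permutes {1..n}" "\<And>i. i \<in> {1..n} \<Longrightarrow> \<phi> (\<alpha> i) = \<alpha> (s i)"
    "t permutes {1..n}" "\<And>i. i \<in> {1..n} \<Longrightarrow> \<phi> (\<beta> i) = \<beta> (t i)"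
    by (rule embedding_permutes_roots) blast
  show "\<phi> (vandermonde_sol n \<alpha> \<beta> \<tau> l) = vandermonde_sol n \<alpha> \<beta> \<tau> l"
    by (rule embedding_vandermonde_sol[OF \<phi> st(1,2,4) \<tau> equivariant[OF \<phi> st] \<open>l < n\<close>])
qed

lemma Spl_subset_if_coefficients_in_base:
  assumes \<tau>: "\<tau> permutes {1..n}"
    and c: "\<And>l. l < n \<Longrightarrow> vandermonde_sol n \<alpha> \<beta> \<tau> l \<in> range to_ac"
  shows "Spl g \<subseteq> Spl f"
  unfolding Spl_eq[of g]
proof (rule gen_field_least[OF field_subset_Spl])
  interpret L: field_subset "Spl f" by (rule field_subset_Spl)
  have "\<beta> m \<in> Spl f" if m: "m \<in> {1..n}" for m
  proof -
    obtain i where i: "i \<in> {1..n}" "m = \<tau> i"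
      using m permutes_image[OF \<tau>] by (metis imageE)
    have "\<beta> (\<tau> i) = (\<Sum>l<n. vandermonde_sol n \<alpha> \<beta> \<tau> l * \<alpha> i ^ l)"
      using inj_\<alpha> i(1) by (intro vandermonde_sol_mem(1)[OF field_subset_UNIV]) auto
    moreover have "\<alpha> i \<in> Spl f"
      using roots_subset_Spl[of f] i(1) by (auto simp: roots_f)
    moreover have "vandermonde_sol n \<alpha> \<beta> \<tau> l \<in> Spl f" if "l < n" for l
      using c[OF that] base_subset_Spl by blast
    ultimately show ?thesis
      using i(2) by (auto intro!: L.sum_mem L.mult_mem L.power_mem)
  qed
  then show "range to_ac \<union> roots_in_closure g \<subseteq> Spl f"
    using base_subset_Spl[of f] by (auto simp: roots_g)
qed

lemma poly_F_poly_eq_0_iff: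
  "poly (F_poly n j \<alpha> \<beta>) x = 0 \<longleftrightarrow> (\<exists>\<tau>. \<tau> permutes {1..n} \<and> x = vandermonde_sol n \<alpha> \<beta> \<tau> j)"
  by (auto simp: F_poly_def poly_prod finite_permutations)

text \<open>A single coefficient in M suffices: it is fixed by \<open>\<phi>\<close>, and since
  distinct permutations have distinct coefficients at \<open>j\<close>, the permutation itself is
  preserved.\<close>

lemma equivariant_if_root:
  assumes sqf: "rsquarefree (F_poly n j \<alpha> \<beta>)" and "j < n"
    and \<tau>: "\<tau> permutes {1..n}" and root: "to_ac x = vandermonde_sol n \<alpha> \<beta> \<tau> j"
    and \<phi>: "embedding_over_base compositum \<phi>"
    and s: "s permutes {1..n}" "\<And>i. i \<in> {1..n} \<Longrightarrow> \<phi> (\<alpha> i) = \<alpha> (s i)"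
    and t: "t permutes {1..n}" "\<And>i. i \<in> {1..n} \<Longrightarrow> \<phi> (\<beta> i) = \<beta> (t i)"
  shows "t \<circ> \<tau> = \<tau> \<circ> s"
proof -
  define \<tau>' where "\<tau>' = t \<circ> \<tau> \<circ> inv_into UNIV s"
  have \<tau>': "\<tau>' permutes {1..n}"
    unfolding \<tau>'_def by (intro permutes_compose permutes_inv s t \<tau>)
  have eq: "t \<circ> \<tau> = \<tau>' \<circ> s"
    unfolding \<tau>'_def using permutes_inv_o(2)[OF s(1)] by (simp add: comp_assoc)
  interpret embedding_over_base compositum \<phi> by fact
  have "vandermonde_sol n \<alpha> \<beta> \<tau>' j = \<phi> (vandermonde_sol n \<alpha> \<beta> \<tau> j)"
    using embedding_vandermonde_sol[OF \<phi> s t(2) \<tau> eq \<open>j < n\<close>] by simp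
  also have "\<dots> = vandermonde_sol n \<alpha> \<beta> \<tau> j"
    using base_fixed by (simp flip: root)
  finally have "vandermonde_sol n \<alpha> \<beta> \<tau>' j = vandermonde_sol n \<alpha> \<beta> \<tau> j" .
  \<comment> \<open>The factors of \<open>F_poly\<close> are indexed by permutations, so
    squarefreeness separates the permutations and not merely the values.\<close>
  moreover have "inj_on (\<lambda>\<tau>. vandermonde_sol n \<alpha> \<beta> \<tau> j) {\<tau>. \<tau> permutes {1..n}}"
    using sqf unfolding F_poly_def
    by (rule rsquarefree_prod_linear_inj_on) (rule finite_permutations[OF finite_atLeastAtMost])
  ultimately have "\<tau>' = \<tau>" using \<tau> \<tau>' by (auto dest: inj_onD)
  with eq show ?thesis by simp
qed

text \<open>
  Conjugate stabilizers of \<open>\<alpha> 1\<close> and \<open>\<beta> 1\<close> mean that, after replacing \<open>\<alpha> 1\<close> by a conjugate, both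
  have the same stabilizer; \<open>\<sigma> (\<alpha> 1) \<mapsto> \<sigma> (\<beta> 1)\<close> is then a well-defined equivariant bijection.
\<close>

lemma equivariant_permutation_exists:
  assumes eq: "Spl f = Spl g" and "n \<ge> 1"
    and trans: "Gal_transitive_on_roots f" "Gal_transitive_on_roots g"
    and conj: "index_subgroups_conjugate (Gal (Spl f)) n"
  obtains \<tau> where "\<tau> permutes {1..n}"
    "\<And>\<sigma> i k. \<sigma> \<in> carrier (Gal (Spl f)) \<Longrightarrow> i \<in> {1..n} \<Longrightarrow> k \<in> {1..n} \<Longrightarrow> \<sigma> (\<alpha> i) = \<alpha> k \<Longrightarrow>
       \<sigma> (\<beta> (\<tau> i)) = \<beta> (\<tau> k)"
proof -
  define \<Gamma> where "\<Gamma> = Gal (Spl f)"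
  define stab where "stab = stabilizer \<Gamma> (\<lambda>\<sigma>. \<sigma>)"
  have one: "1 \<in> {1..n}" using \<open>n \<ge> 1\<close> by simp
  interpret action: group_action \<Gamma> "Spl f" "\<lambda>\<sigma>. \<sigma>"
    unfolding \<Gamma>_def by (rule group_action_Gal[OF field_subset_Spl base_subset_Spl])
  interpret \<Gamma>: group \<Gamma> using action.group_hom group_hom.axioms(1) by auto
  have \<alpha>_mem: "\<alpha> i \<in> Spl f" and \<beta>_mem: "\<beta> i \<in> Spl f" if "i \<in> {1..n}" for i
    using roots_subset_Spl[of f] roots_subset_Spl[of g] that by (auto simp: eq roots_f roots_g)
  have emb: "embedding_over_base (Spl f) \<sigma>" if "\<sigma> \<in> carrier \<Gamma>" for \<sigma>
    using that unfolding \<Gamma>_def carrier_Gal_iff[OF field_subset_Spl base_subset_Spl] by blast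
  have \<beta>_image: "\<sigma> (\<beta> i) \<in> \<beta> ` {1..n}" if "\<sigma> \<in> carrier \<Gamma>" "i \<in> {1..n}" for \<sigma> i
  proof -
    interpret embedding_over_base "Spl f" \<sigma> by (rule emb[OF that(1)])
    have "roots_in_closure g \<subseteq> Spl f" using roots_subset_Spl[of g] by (simp add: eq)
    from bij_betwE[OF bij_betw_roots[OF poly_nonzero_if_lists_roots[OF lists_g] this]] that(2)
    show ?thesis unfolding roots_g by blast
  qed
  \<comment> \<open>Equality of the splitting fields is what places both stabilizers in the same
    group.\<close>
  have "subgroup (stab (\<alpha> 1)) \<Gamma> \<and> card (rcosets\<^bsub>\<Gamma>\<^esub> stab (\<alpha> 1)) = n \<and>
      subgroup (stab (\<beta> 1)) \<Gamma> \<and> card (rcosets\<^bsub>\<Gamma>\<^esub> stab (\<beta> 1)) = n"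
    using action.stabilizer_subgroup[OF \<alpha>_mem[OF one]] action.stabilizer_subgroup[OF \<beta>_mem[OF one]]
      card_rcosets_stabilizer_root[OF lists_f inj_\<alpha> poly_nonzero_if_lists_roots[OF lists_f] trans(1) one]
      card_rcosets_stabilizer_root[OF lists_g inj_\<beta> poly_nonzero_if_lists_roots[OF lists_g] trans(2) one]
    by (simp add: stab_def \<Gamma>_def eq)
  then have "\<exists>\<gamma>\<in>carrier \<Gamma>. stab (\<beta> 1) = (\<lambda>h. \<gamma> \<otimes>\<^bsub>\<Gamma>\<^esub> h \<otimes>\<^bsub>\<Gamma>\<^esub> inv\<^bsub>\<Gamma>\<^esub> \<gamma>) ` stab (\<alpha> 1)"
    by (rule conj[folded \<Gamma>_def, unfolded index_subgroups_conjugate_def, rule_format])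
  then obtain \<gamma> where \<gamma>: "\<gamma> \<in> carrier \<Gamma>"
    and conj_stab: "stab (\<beta> 1) = (\<lambda>h. \<gamma> \<otimes>\<^bsub>\<Gamma>\<^esub> h \<otimes>\<^bsub>\<Gamma>\<^esub> inv\<^bsub>\<Gamma>\<^esub> \<gamma>) ` stab (\<alpha> 1)" ..
  define x where "x = \<gamma> (\<alpha> 1)"
  have x: "x \<in> Spl f"
    unfolding x_def by (rule action.element_image[OF \<gamma> \<alpha>_mem[OF one] refl])
  have same_stab: "\<sigma> x = \<sigma>' x \<longleftrightarrow> \<sigma> (\<beta> 1) = \<sigma>' (\<beta> 1)"
    if "\<sigma> \<in> carrier \<Gamma>" "\<sigma>' \<in> carrier \<Gamma>" for \<sigma> \<sigma>'
    unfolding x_def using that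
    by (rule action.conjugate_stabilizers_equivariant
        [OF \<alpha>_mem[OF one] \<beta>_mem[OF one] \<gamma> conj_stab[unfolded stab_def]])
  \<comment> \<open>Undoing \<open>\<gamma>\<close> returns \<open>x\<close> to
    \<open>\<alpha> 1\<close>, from which transitivity reaches every
    \<open>\<alpha> i\<close>.\<close>
  have "\<exists>\<sigma>\<in>carrier \<Gamma>. \<sigma> x = \<alpha> i" if i: "i \<in> {1..n}" for i
  proof -
    obtain \<sigma> where \<sigma>: "\<sigma> \<in> carrier \<Gamma>" "\<sigma> (\<alpha> 1) = \<alpha> i"
      using trans(1) i one unfolding Gal_transitive_on_roots_def roots_f \<Gamma>_def by blast
    have "(\<sigma> \<otimes>\<^bsub>\<Gamma>\<^esub> inv\<^bsub>\<Gamma>\<^esub> \<gamma>) x = \<alpha> i"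
      using action.composition_rule[OF x \<sigma>(1) \<Gamma>.inv_closed[OF \<gamma>]] \<sigma>(2)
        action.orbit_sym_aux[OF \<gamma> \<alpha>_mem[OF one] refl] by (simp add: x_def)
    then show ?thesis using \<sigma>(1) \<gamma> by blast
  qed
  then obtain \<rho> where \<rho>: "\<And>i. i \<in> {1..n} \<Longrightarrow> \<rho> i \<in> carrier \<Gamma>" "\<And>i. i \<in> {1..n} \<Longrightarrow> \<rho> i x = \<alpha> i"
    by metis
  \<comment> \<open>The index of the root \<open>\<rho> i (\<beta> 1)\<close>. By
    \<open>same_stab\<close> this root depends only on \<open>\<alpha> i\<close> and not on the
    choice of \<open>\<rho> i\<close>; the converse direction of \<open>same_stab\<close> gives
    injectivity.\<close>
  define \<tau> where "\<tau> i = (if i \<in> {1..n} then inv_into {1..n} \<beta> (\<rho> i (\<beta> 1)) else i)" for i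
  have \<tau>: "\<tau> i \<in> {1..n}" "\<beta> (\<tau> i) = \<rho> i (\<beta> 1)" if "i \<in> {1..n}" for i
    using \<beta>_image[OF \<rho>(1)[OF that] one] that
    by (auto simp: \<tau>_def f_inv_into_f simp del: atLeastAtMost_iff intro: inv_into_into)
  have "inj_on \<tau> {1..n}"
  proof (rule inj_onI)
    fix i k assume ik: "i \<in> {1..n}" "k \<in> {1..n}" "\<tau> i = \<tau> k"
    then have "\<rho> i (\<beta> 1) = \<rho> k (\<beta> 1)" using \<tau>(2) by metis
    then have "\<alpha> i = \<alpha> k" using same_stab[of "\<rho> i" "\<rho> k"] \<rho> ik by simp
    then show "i = k" using inj_\<alpha> ik by (auto dest: inj_onD)
  qed
  moreover have "\<tau> ` {1..n} \<subseteq> {1..n}" using \<tau>(1) by blast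
  ultimately have "bij_betw \<tau> {1..n} {1..n}"
    by (simp add: bij_betw_def endo_inj_surj)
  then have "\<tau> permutes {1..n}" by (rule bij_imp_permutes) (simp only: \<tau>_def if_False)
  moreover have "\<sigma> (\<beta> (\<tau> i)) = \<beta> (\<tau> k)"
    if "\<sigma> \<in> carrier (Gal (Spl f))" "i \<in> {1..n}" "k \<in> {1..n}" "\<sigma> (\<alpha> i) = \<alpha> k" for \<sigma> i k
  proof -
    have \<sigma>: "\<sigma> \<in> carrier \<Gamma>" using that(1) by (simp add: \<Gamma>_def)
    \<comment> \<open>Both automorphisms send \<open>x\<close> to \<open>\<alpha> k\<close>, so by
      \<open>same_stab\<close> they agree at \<open>\<beta> 1\<close> as well.\<close>
    have "(\<sigma> \<otimes>\<^bsub>\<Gamma>\<^esub> \<rho> i) x = \<rho> k x"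
      using action.composition_rule[OF x \<sigma> \<rho>(1)] \<rho>(2) that by simp
    then have "(\<sigma> \<otimes>\<^bsub>\<Gamma>\<^esub> \<rho> i) (\<beta> 1) = \<rho> k (\<beta> 1)"
      using same_stab[of "\<sigma> \<otimes>\<^bsub>\<Gamma>\<^esub> \<rho> i" "\<rho> k"] \<sigma> \<rho>(1) that by simp
    then show ?thesis
      using action.composition_rule[OF \<beta>_mem[OF one] \<sigma> \<rho>(1)] \<tau>(2) that by simp
  qed
  ultimately show ?thesis by (rule that)
qed

text \<open>When the splitting fields coincide, the compositum is \<open>Spl f\<close>, so each of
  its embeddings restricts to a Galois automorphism, for which the permutation just constructed is
  equivariant.\<close>

lemma root_if_Spl_eq:
  assumes eq: "Spl f = Spl g" and "j < n"
    and trans: "Gal_transitive_on_roots f" "Gal_transitive_on_roots g"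
    and conj: "index_subgroups_conjugate (Gal (Spl f)) n"
  shows "\<exists>x. poly (F_poly n j \<alpha> \<beta>) (to_ac x) = 0"
proof -
  obtain \<tau> where \<tau>: "\<tau> permutes {1..n}"
    and equivariant: "\<And>\<sigma> i k. \<sigma> \<in> carrier (Gal (Spl f)) \<Longrightarrow> i \<in> {1..n} \<Longrightarrow> k \<in> {1..n} \<Longrightarrow>
       \<sigma> (\<alpha> i) = \<alpha> k \<Longrightarrow> \<sigma> (\<beta> (\<tau> i)) = \<beta> (\<tau> k)"
    using equivariant_permutation_exists[OF eq _ trans conj] \<open>j < n\<close> by auto
  have comp: "compositum = Spl f"
  proof
    show "compositum \<subseteq> Spl f"
      unfolding compositum_def
      using base_subset_Spl[of f] roots_subset_Spl[of f] roots_subset_Spl[of g]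
      by (intro gen_field_least field_subset_Spl) (simp add: eq)
    show "Spl f \<subseteq> compositum"
      unfolding compositum_def Spl_eq by (intro gen_field_mono) auto
  qed
  have "vandermonde_sol n \<alpha> \<beta> \<tau> j \<in> range to_ac"
  proof (rule coefficients_in_base[OF \<tau> _ \<open>j < n\<close>])
    fix \<phi> s t
    assume \<phi>: "embedding_over_base compositum \<phi>"
      and s: "s permutes {1..n}" "\<And>i. i \<in> {1..n} \<Longrightarrow> \<phi> (\<alpha> i) = \<alpha> (s i)"
      and t: "t permutes {1..n}" "\<And>i. i \<in> {1..n} \<Longrightarrow> \<phi> (\<beta> i) = \<beta> (t i)"
    have \<sigma>: "restrict \<phi> (Spl f) \<in> carrier (Gal (Spl f))"
      using \<phi> unfolding comp
      by (rule embedding_Spl_in_Gal[OF _ poly_nonzero_if_lists_roots[OF lists_f]])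
    show "t \<circ> \<tau> = \<tau> \<circ> s"
    proof
      fix i
      show "(t \<circ> \<tau>) i = (\<tau> \<circ> s) i"
      proof (cases "i \<in> {1..n}")
        case True
        have in_range: "\<tau> i \<in> {1..n}" "s i \<in> {1..n}" "t (\<tau> i) \<in> {1..n}" "\<tau> (s i) \<in> {1..n}"
          using True permutes_in_image[OF \<tau>] permutes_in_image[OF s(1)] permutes_in_image[OF t(1)]
          by blast+
        have "\<phi> (\<beta> (\<tau> i)) = \<beta> (\<tau> (s i))"
          using equivariant[OF \<sigma> True in_range(2)] s(2)[OF True] root_mem_compositum in_range(1) True
          by (simp add: comp)
        then have "\<beta> (t (\<tau> i)) = \<beta> (\<tau> (s i))" using t(2)[OF in_range(1)] by simp
        then show ?thesis using inj_\<beta> in_range by (auto dest: inj_onD)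
      next
        case False
        then show ?thesis
          using permutes_not_in[OF \<tau>] permutes_not_in[OF s(1)] permutes_not_in[OF t(1)] by simp
      qed
    qed
  qed
  then obtain x where "to_ac x = vandermonde_sol n \<alpha> \<beta> \<tau> j" by (metis imageE)
  then show ?thesis using \<tau> unfolding poly_F_poly_eq_0_iff by blast
qed

end

lemma root_pair_swap: "root_pair n f g \<alpha> \<beta> \<Longrightarrow> root_pair n g f \<beta> \<alpha>"
  by (simp add: root_pair_def)

text \<open>The second inclusion exchanges the polynomials and uses the inverse of
  \<open>\<tau>\<close>. Its equivariance is inherited from \<open>\<tau>\<close>, so the argument
  about simple roots is made only once, for \<open>F_poly n j \<alpha> \<beta>\<close>.\<close>

lemma (in root_pair) Spl_eq_if_root:
  assumes sqf: "rsquarefree (F_poly n j \<alpha> \<beta>)" and "j < n"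
    and root: "poly (F_poly n j \<alpha> \<beta>) (to_ac x) = 0"
  shows "Spl f = Spl g"
proof
  interpret swap: root_pair n g f \<beta> \<alpha> by (rule root_pair_swap) (rule root_pair_axioms)
  obtain \<tau> where \<tau>: "\<tau> permutes {1..n}" and x: "to_ac x = vandermonde_sol n \<alpha> \<beta> \<tau> j"
    using root unfolding poly_F_poly_eq_0_iff by blast
  note equivariant = equivariant_if_root[OF sqf \<open>j < n\<close> \<tau> x]
  show "Spl g \<subseteq> Spl f"
    by (rule Spl_subset_if_coefficients_in_base[OF \<tau>], rule coefficients_in_base[OF \<tau>])
       (rule equivariant)
  have \<tau>_inv: "inv_into UNIV \<tau> permutes {1..n}" by (rule permutes_inv[OF \<tau>])
  have comp: "swap.compositum = compositum"
    by (simp add: swap.compositum_def compositum_def Un_commute)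
  show "Spl f \<subseteq> Spl g"
  proof (rule swap.Spl_subset_if_coefficients_in_base[OF \<tau>_inv],
      rule swap.coefficients_in_base[OF \<tau>_inv])
    fix \<phi> t s
    assume "embedding_over_base swap.compositum \<phi>"
      and t: "t permutes {1..n}" "\<And>i. i \<in> {1..n} \<Longrightarrow> \<phi> (\<beta> i) = \<beta> (t i)"
      and s: "s permutes {1..n}" "\<And>i. i \<in> {1..n} \<Longrightarrow> \<phi> (\<alpha> i) = \<alpha> (s i)"
    then have "t \<circ> \<tau> = \<tau> \<circ> s"
      unfolding comp by (intro equivariant)
    \<comment> \<open>Composing the equivariance relation with the inverse of \<open>\<tau>\<close>
      on both sides gives the relation for that inverse, with \<open>s\<close> and \<open>t\<close>
      exchanged.\<close>
    then have "inv_into UNIV \<tau> \<circ> (t \<circ> \<tau>) \<circ> inv_into UNIV \<tau> = inv_into UNIV \<tau> \<circ> (\<tau> \<circ> s) \<circ> inv_into UNIV \<tau>" by simp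
    then show "s \<circ> inv_into UNIV \<tau> = inv_into UNIV \<tau> \<circ> t"
      using permutes_inv_o[OF \<tau>] by (simp add: comp_assoc) (simp flip: comp_assoc)
  qed
qed

theorem corollary3p9:
  fixes n j :: nat
    and k :: "'m :: field set"
    and a b :: "nat \<Rightarrow> 'm"
    and \<alpha> \<beta> :: "nat \<Rightarrow> 'm alg_closure"
    and G :: "(nat \<Rightarrow> nat) set"
  assumes "n \<ge> 3"
    and "subfield k (ring_of_type_algebra :: 'm ring)"
    and "infinite (UNIV :: 'm set)"
    and "lists_roots n (f_poly n a) \<alpha>"
    and "lists_roots n (f_poly n b) \<beta>"
    and "rsquarefree (map_poly to_ac (f_poly n a))"
    and "rsquarefree (map_poly to_ac (f_poly n b))"
    and "j \<le> n - 1"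
    and "rsquarefree (F_poly n j \<alpha> \<beta>)"
    and "transitive_subgroup n G"
    and "Gal (Spl (f_poly n a)) \<cong> perm_group n G" and "Gal_transitive_on_roots (f_poly n a)"
    and "Gal (Spl (f_poly n b)) \<cong> perm_group n G" and "Gal_transitive_on_roots (f_poly n b)"
    and "index_subgroups_conjugate (perm_group n G) n"
  shows "(\<exists>x :: 'm. poly (F_poly n j \<alpha> \<beta>) (to_ac x) = 0) \<longleftrightarrow>
         Spl (f_poly n a) = Spl (f_poly n b)"
proof -
  \<comment> \<open>Absence of multiple roots is used in the form that the listed roots are
    distinct.\<close>
  have inj: "inj_on \<alpha> {1..n}" "inj_on \<beta> {1..n}"
    using assms(4-7) unfolding lists_roots_def
    by (auto intro!: rsquarefree_prod_linear_inj_on)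
  interpret root_pair n "f_poly n a" "f_poly n b" \<alpha> \<beta>
    by unfold_locales (fact assms(4) assms(5) inj)+
  have j: "j < n" using assms(1,8) by simp
  have "group (sym_group n)" by (rule sym_group_is_group)
  then have G: "group (perm_group n G)"
    using assms(10) by (auto simp: transitive_subgroup_def intro: subgroup.subgroup_is_group)
  interpret action: group_action "Gal (Spl (f_poly n a))" "Spl (f_poly n a)" "\<lambda>\<sigma>. \<sigma>"
    by (rule group_action_Gal[OF field_subset_Spl base_subset_Spl])
  have "group (Gal (Spl (f_poly n a)))"
    using action.group_hom group_hom.axioms(1) by auto
  with G assms(11,15) have "index_subgroups_conjugate (Gal (Spl (f_poly n a))) n"
    by (auto simp: is_iso_def intro: index_subgroups_conjugate_iso)
  then show ?thesis
    using Spl_eq_if_root[OF assms(9) j] root_if_Spl_eq[OF _ j assms(12,14)] by blast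
qed

end
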